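(* Let $\xi_1, \ldots, \xi_n$ be independent real-valued scalar random variables, each with finite support. Let $\mathbf{u}_1, \dots, \mathbf{u}_n \in \mathbb{C}^m$ and set $$\sigma^2 = \left\| \sum_{i=1}^n \mathrm{Var}[ \xi_i ] (\mathbf{u}_i \mathbf{u}_i^{*})^2 \right\|.$$ Then there exists a choice of outcomes $\varepsilon_1,\ldots,\varepsilon_n$, with each $\varepsilon_i$ in the support of $\xi_i$, such that $$\left\|\sum_{i=1}^n \mathbb{E} [ \xi_i] \mathbf{u}_i \mathbf{u}_i^* - \sum_{i=1}^n \varepsilon_i \mathbf{u}_i \mathbf{u}_i^* \right\| \leq 4 \sigma.$$
   Context: $\|\cdot\|$ denotes the operator (spectral) norm of a matrix, and $\mathbf{u}^*$ the conjugate transpose. *)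

theory Defs
  imports "HOL-Probability.Probability"
begin

text \<open>The topological support of the law of a real random variable.  When this set is finite it is
  exactly the set of atoms, and the law is concentrated on it.\<close>

definition rv_support :: "'a measure \<Rightarrow> ('a \<Rightarrow> real) \<Rightarrow> real set" where
  "rv_support M X = {x. \<forall>U. open U \<longrightarrow> x \<in> U \<longrightarrow> measure (distr M borel X) U > 0}"

definition outer_self :: "complex ^ 'm \<Rightarrow> complex ^ 'm ^ 'm" where
  "outer_self u = (\<chi> i j. u $ i * cnj (u $ j))"

text \<open>The norm on \<^typ>\<open>complex ^ 'm\<close> is the Hermitian Euclidean norm.\<close>

definition spectral_norm :: "complex ^ 'm ^ 'm \<Rightarrow> real" where
  "spectral_norm A = onorm (\<lambda>v. A *v v)"

end

theory Submission
  imports Defs "HOL-Complex_Analysis.Complex_Analysis"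
begin

text \<open>
  Let \<open>D x y = det (x I + \<Sum> y\<^sub>i u\<^sub>i u\<^sub>i\<^sup>*)\<close> and let \<open>\<zeta>\<^sub>i\<close> be the centred variables. The polynomial
  \<open>E [D x (-\<zeta>) * D x \<zeta>]\<close> arises from the multiaffine, stable polynomial \<open>D x y * D x z\<close> by the
  operators \<open>1 - Var \<xi>\<^sub>i \<partial>\<^sub>y\<^sub>i \<partial>\<^sub>z\<^sub>i\<close>, which preserve stability by the Lieb-Sokal argument. Hence all
  polynomials obtained by fixing some outcomes and averaging over any laws of the others are
  real-rooted, and outcomes can be fixed one at a time without enlarging the largest root. The
  largest root of the expected polynomial is below \<open>4 \<sigma>\<close> by a barrier argument: the logarithmic
  derivatives are controlled while the point \<open>(y\<^sub>i, z\<^sub>i) = (-\<delta>\<^sub>i, -\<delta>\<^sub>i)\<close> is moved to the origin.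
  Once all outcomes are fixed, the roots are \<open>\<plusminus>\<close> the eigenvalues of \<open>\<Sum> \<zeta>\<^sub>i u\<^sub>i u\<^sub>i\<^sup>*\<close>.
\<close>

text \<open>The product is affine in each of \<open>y\<^sub>i\<close> and \<open>z\<^sub>i\<close>,
  so averaging over a centred variable kills the linear terms and leaves exactly one second-order
  term: a law enters only through its variance. Hence a mixture of a centred law and a point mass
  stays, after recentring, in the same real-rooted family, which is what comparing roots before and
  after fixing an outcome needs. The obstacle for the barrier is that each operator couples two
  different variables. A bound on the two separate logarithmic derivatives gives positivity of the
  new polynomial, but not control of its logarithmic derivatives in the remaining coordinates. For
  that, \<open>y\<^sub>i\<close> and \<open>z\<^sub>i\<close> are raised together, and along this
  diagonal stability supplies a positive semidefinite Bezout matrix of two quadratics. The bound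
  splits as 2 \<sigma> + 2 \<sigma>: one half pays for lowering the starting point by the \<delta>,
  the other is the gap that bounds the initial logarithmic derivatives.\<close>

unbundle no fps_syntax

section \<open>Multiaffine functions and stability\<close>

text \<open>On multiaffine functions this is the partial derivative in coordinate \<open>a\<close>.
  As a finite difference it is purely algebraic and serves \<open>real\<close> and
  \<open>complex\<close> alike.\<close>

definition slope :: "'k \<Rightarrow> (('k \<Rightarrow> 'a) \<Rightarrow> 'a) \<Rightarrow> ('k \<Rightarrow> 'a) \<Rightarrow> 'a::comm_ring_1" where
  "slope a p \<zeta> = p (\<zeta>(a := 1)) - p (\<zeta>(a := 0))"

definition multiaffine :: "(('k \<Rightarrow> 'a) \<Rightarrow> 'a::comm_ring_1) \<Rightarrow> bool" where
  "multiaffine p \<longleftrightarrow> (\<forall>a \<zeta> v. p (\<zeta>(a := v)) = p \<zeta> + (v - \<zeta> a) * slope a p \<zeta>)"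

text \<open>On multiaffine functions this is the differential operator 1 - s \<partial>a
  \<partial>b.\<close>

definition lieb_sokal :: "'a \<Rightarrow> 'k \<Rightarrow> 'k \<Rightarrow> (('k \<Rightarrow> 'a) \<Rightarrow> 'a) \<Rightarrow> ('k \<Rightarrow> 'a) \<Rightarrow> 'a::comm_ring_1" where
  "lieb_sokal s a b p \<zeta> = p \<zeta> - s * slope a (slope b p) \<zeta>"

lemma multiaffineD:
  "multiaffine p \<Longrightarrow> p (\<zeta>(a := v)) = p \<zeta> + (v - \<zeta> a) * slope a p \<zeta>"
  unfolding multiaffine_def by blast

lemma multiaffineI:
  assumes "\<And>a \<zeta>. \<exists>c d. \<forall>v. p (\<zeta>(a := v)) = c + v * d"
  shows "multiaffine p"
  unfolding multiaffine_def
proof (intro allI)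
  fix a \<zeta> v
  obtain c d where cd: "\<And>v. p (\<zeta>(a := v)) = c + v * d" using assms by blast
  have "p \<zeta> = c + \<zeta> a * d" using cd[of "\<zeta> a"] by simp
  then show "p (\<zeta>(a := v)) = p \<zeta> + (v - \<zeta> a) * slope a p \<zeta>"
    by (simp add: slope_def cd algebra_simps)
qed

lemma slope_upd_same [simp]: "slope a p (\<zeta>(a := v)) = slope a p \<zeta>"
  by (simp add: slope_def)

lemma slope_slope_same [simp]: "slope a (slope a p) \<zeta> = 0"
  by (simp add: slope_def)

lemma slope_commute: "slope a (slope b p) = slope b (slope a p)"
  by (cases "a = b") (auto simp: slope_def fun_upd_twist fun_eq_iff)

lemma slope_diff_scale: "slope a (\<lambda>\<zeta>. p \<zeta> - s * q \<zeta>) \<zeta> = slope a p \<zeta> - s * slope a q \<zeta>"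
  by (simp add: slope_def algebra_simps)

lemma slope_lieb_sokal: "slope w (lieb_sokal s a b p) = lieb_sokal s a b (slope w p)"
proof
  fix \<zeta>
  have "lieb_sokal s a b p = (\<lambda>\<zeta>. p \<zeta> - s * slope a (slope b p) \<zeta>)"
    by (simp add: lieb_sokal_def fun_eq_iff)
  then show "slope w (lieb_sokal s a b p) \<zeta> = lieb_sokal s a b (slope w p) \<zeta>"
    by (simp add: slope_diff_scale lieb_sokal_def) (metis slope_commute)
qed

lemma multiaffine_slope:
  assumes "multiaffine p" shows "multiaffine (slope b p)"
  unfolding multiaffine_def
proof (intro allI)
  fix a \<zeta> v
  show "slope b p (\<zeta>(a := v)) = slope b p \<zeta> + (v - \<zeta> a) * slope a (slope b p) \<zeta>"
  proof (cases "a = b")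
    case False
    then have "slope b p (\<zeta>(a := v)) = p ((\<zeta>(b := 1))(a := v)) - p ((\<zeta>(b := 0))(a := v))"
      by (simp add: slope_def fun_upd_twist)
    also have "\<dots> = slope b p \<zeta> + (v - \<zeta> a) * slope b (slope a p) \<zeta>"
      using False by (simp add: multiaffineD[OF assms]) (simp add: slope_def algebra_simps)
    finally show ?thesis by (metis slope_commute)
  qed simp
qed

lemma multiaffine_lieb_sokal:
  assumes "multiaffine p" shows "multiaffine (lieb_sokal s a b p)"
  unfolding multiaffine_def
proof (intro allI)
  fix c \<zeta> v
  have "slope a (slope b (slope c p)) = slope c (slope a (slope b p))" by (metis slope_commute)
  then show "lieb_sokal s a b p (\<zeta>(c := v)) =
      lieb_sokal s a b p \<zeta> + (v - \<zeta> c) * slope c (lieb_sokal s a b p) \<zeta>"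
    unfolding slope_lieb_sokal
    by (simp add: lieb_sokal_def multiaffineD[OF assms]
        multiaffineD[OF multiaffine_slope[OF multiaffine_slope[OF assms]]] algebra_simps)
qed

lemma multiaffine_upd2:
  assumes "multiaffine p" "a \<noteq> b"
  shows "p (\<zeta>(a := \<zeta> a + y, b := \<zeta> b + z)) =
    p \<zeta> + y * slope a p \<zeta> + z * slope b p \<zeta> + y * z * slope a (slope b p) \<zeta>"
proof -
  have "p (\<zeta>(a := \<zeta> a + y, b := \<zeta> b + z)) =
      p (\<zeta>(a := \<zeta> a + y)) + z * slope b p (\<zeta>(a := \<zeta> a + y))"
    using assms(2) multiaffineD[OF assms(1), of "\<zeta>(a := \<zeta> a + y)" b] by simp
  then show ?thesis
    by (simp add: multiaffineD[OF assms(1)] multiaffineD[OF multiaffine_slope[OF assms(1)]] algebra_simps)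
qed

section \<open>Zero-free half planes and the Lieb-Sokal operator\<close>

definition stable_above :: "real \<Rightarrow> (('k \<Rightarrow> complex) \<Rightarrow> complex) \<Rightarrow> bool" where
  "stable_above \<eta> p \<longleftrightarrow> (\<forall>\<zeta>. (\<forall>k. Im (\<zeta> k) > \<eta>) \<longrightarrow> p \<zeta> \<noteq> 0)"

text \<open>Zero-freeness forces Im (B / E) > 0: otherwise the coefficient B + z E of y vanishes at
  some z0 in the closed upper half plane, and for suitable z near z0 the root y escapes to infinity
  upwards. If A = s E, then y = - A / B, z = 0 would be a forbidden zero.\<close>

lemma biaffine_zero_free:
  fixes A B C E :: complex
  assumes nz: "\<And>y z. Im y > -h \<Longrightarrow> Im z > -h \<Longrightarrow> A + y * B + z * C + y * z * E \<noteq> 0"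
    and "h > 0" "s \<ge> (0::real)"
  shows "A - s * E \<noteq> 0"
proof
  assume eq: "A - s * E = 0"
  have "A \<noteq> 0" using nz[of 0 0] \<open>h > 0\<close> by simp
  with eq have "s > 0" "E \<noteq> 0" using \<open>s \<ge> 0\<close> by (auto simp: less_le)
  have ImBE: "Im (B / E) > 0"
  proof (rule ccontr)
    assume neg: "\<not> Im (B / E) > 0"
    define z0 where "z0 = - (B / E)"
    define P0 where "P0 = A + z0 * C"
    have z0: "Im z0 \<ge> 0" "B + z0 * E = 0" using neg \<open>E \<noteq> 0\<close> by (auto simp: z0_def)
    have "A + 0 * B + z0 * C + 0 * z0 * E \<noteq> 0" using nz[of 0 z0] z0 \<open>h > 0\<close> by force
    then have "P0 \<noteq> 0" by (simp add: P0_def)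
    define K where "K = cmod (P0 / E)"
    have "K > 0" using \<open>P0 \<noteq> 0\<close> \<open>E \<noteq> 0\<close> by (simp add: K_def)
    \<comment> \<open>\<open>\<rho>\<close> is the size of the perturbation of \<open>z0\<close>:
      small enough to stay above height -h and to make K / \<rho> exceed the bounded term Im (C /
      E). The argument of \<open>w\<close> below is chosen so that P0 / (w E) is a negative multiple
      of \<i>, which sends the root \<open>y\<close> upwards.\<close>
    define \<rho> where "\<rho> = min (h / 2) (K / (\<bar>Im (C / E)\<bar> + 1))"
    have "\<rho> \<le> h / 2" unfolding \<rho>_def by (rule min.cobounded1)
    then have \<rho>: "\<rho> > 0" "\<rho> < h" "\<rho> \<le> K / (\<bar>Im (C / E)\<bar> + 1)"
      using \<open>h > 0\<close> \<open>K > 0\<close> by (auto simp: \<rho>_def)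
    have K\<rho>: "K / \<rho> \<ge> \<bar>Im (C / E)\<bar> + 1"
      using \<rho> \<open>K > 0\<close> by (simp add: field_simps)
    define w where "w = \<rho> * (\<i> * (P0 / E) / K)"
    have "cmod w = \<rho>" using \<rho> \<open>P0 \<noteq> 0\<close> \<open>E \<noteq> 0\<close> by (simp add: w_def norm_mult norm_divide K_def)
    then have Imw: "Im (z0 + w) > -h" using abs_Im_le_cmod[of w] \<rho> z0 by simp
    have "w \<noteq> 0" using \<open>cmod w = \<rho>\<close> \<rho> by auto
    define y where "y = - (P0 + w * C) / (w * E)"
    have "P0 / (w * E) = - \<i> * of_real (K / \<rho>)"
      using \<open>P0 \<noteq> 0\<close> \<open>E \<noteq> 0\<close> \<rho> \<open>K > 0\<close> by (simp add: w_def field_simps)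
    moreover have "y = - (P0 / (w * E)) - C / E"
      using \<open>w \<noteq> 0\<close> \<open>E \<noteq> 0\<close> by (simp add: y_def field_simps)
    ultimately have "Im y = K / \<rho> - Im (C / E)" by simp
    then have Imy: "Im y > -h" using K\<rho> \<open>h > 0\<close> by linarith
    have "A + y * B + (z0 + w) * C + y * (z0 + w) * E = P0 + w * C + y * (B + z0 * E) + y * (w * E)"
      by (simp add: P0_def algebra_simps)
    also have "\<dots> = 0" using z0 \<open>w \<noteq> 0\<close> \<open>E \<noteq> 0\<close> by (simp add: y_def)
    finally show False using nz[OF Imy Imw] by simp
  qed
  then have "B \<noteq> 0" by auto
  \<comment> \<open>Inversion reverses the sign of the imaginary part, and A / B is s times E /
    B.\<close>
  have "Im (E / B) < 0"
    using ImBE unfolding Im_complex_div_gt_0 Im_complex_div_lt_0 by (simp add: mult.commute)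
  moreover have "A / B = of_real s * (E / B)" using eq by simp
  then have "Im (A / B) = s * Im (E / B)" by (simp only: times_complex.simps) simp
  ultimately have "Im (- (A / B)) > 0" using \<open>s > 0\<close> by (simp add: mult_pos_neg)
  then have "A + (- (A / B)) * B + 0 * C + (- (A / B)) * 0 * E \<noteq> 0"
    using \<open>h > 0\<close> by (intro nz) auto
  then show False using \<open>B \<noteq> 0\<close> by simp
qed

text \<open>With all other coordinates frozen, the expansion at \<zeta> is biaffine, and
  \<open>h\<close> is the room left below the two moved coordinates. Negative \<eta> is allowed, so
  that the zero-free region can contain the real points.\<close>

lemma stable_above_lieb_sokal:
  assumes "multiaffine p" "stable_above \<eta> p" "a \<noteq> b" "s \<ge> 0"
  shows "stable_above \<eta> (lieb_sokal (of_real s) a b p)"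
  unfolding stable_above_def
proof (intro allI impI)
  fix \<zeta> :: "'a \<Rightarrow> complex"
  assume \<zeta>: "\<forall>k. Im (\<zeta> k) > \<eta>"
  define h where "h = min (Im (\<zeta> a) - \<eta>) (Im (\<zeta> b) - \<eta>)"
  have "h > 0" using \<zeta> by (simp add: h_def)
  show "lieb_sokal (of_real s) a b p \<zeta> \<noteq> 0"
    unfolding lieb_sokal_def
  proof (rule biaffine_zero_free[OF _ \<open>h > 0\<close> \<open>s \<ge> 0\<close>])
    fix y z assume "Im y > -h" "Im z > -h"
    then have "\<forall>k. Im ((\<zeta>(a := \<zeta> a + y, b := \<zeta> b + z)) k) > \<eta>"
      using \<zeta> by (auto simp: h_def)
    then show "p \<zeta> + y * slope a p \<zeta> + z * slope b p \<zeta> + y * z * slope a (slope b p) \<zeta> \<noteq> 0"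
      using assms(2) multiaffine_upd2[OF assms(1,3), of \<zeta> y z]
      unfolding stable_above_def by metis
  qed
qed

lemma continuous_on_fun_upd [continuous_intros]:
  "continuous_on UNIV (\<lambda>\<zeta> :: 'k \<Rightarrow> 'b::topological_space. \<zeta>(a := v))"
proof (rule continuous_on_coordinatewise_then_product)
  fix i show "continuous_on UNIV (\<lambda>\<zeta> :: 'k \<Rightarrow> 'b. (\<zeta>(a := v)) i)"
    by (cases "i = a") auto
qed

lemma continuous_on_slope:
  fixes p :: "('k \<Rightarrow> complex) \<Rightarrow> complex"
  assumes "continuous_on UNIV p" shows "continuous_on UNIV (slope a p)"
proof -
  have "continuous_on UNIV (\<lambda>\<zeta>. p (\<zeta>(a := v)))" for v
    using continuous_on_compose2[OF assms continuous_on_fun_upd] by blast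
  then show ?thesis unfolding slope_def[abs_def] by (intro continuous_intros)
qed

lemma continuous_on_lieb_sokal:
  fixes p :: "('k \<Rightarrow> complex) \<Rightarrow> complex"
  assumes "continuous_on UNIV p" shows "continuous_on UNIV (lieb_sokal s a b p)"
  unfolding lieb_sokal_def[abs_def]
  by (intro continuous_intros assms continuous_on_slope)

text \<open>In the open region the root of p in the shift of coordinate \<open>w\<close> is - p /
  slope, which must have negative imaginary part. Writing this with a conjugate instead of a
  quotient allows a zero slope and passes to the closed half planes by letting all coordinates
  descend along \<i> t.\<close>

lemma stable_Im_nonneg:
  assumes p: "multiaffine p" "stable_above 0 p" "continuous_on UNIV p"
    and \<zeta>: "\<And>k. Im (\<zeta> k) \<ge> 0"
  shows "Im (p \<zeta> * cnj (slope w p \<zeta>)) \<ge> 0"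
proof -
  have strict: "Im (p \<zeta> * cnj (slope w p \<zeta>)) \<ge> 0" if "\<And>k. Im (\<zeta> k) > 0" for \<zeta>
  proof (cases "slope w p \<zeta> = 0")
    case False
    define v where "v = - (p \<zeta> / slope w p \<zeta>)"
    have "p (\<zeta>(w := \<zeta> w + v)) = 0"
      using False by (simp add: multiaffineD[OF p(1)] v_def)
    then have "\<not> (\<forall>k. Im ((\<zeta>(w := \<zeta> w + v)) k) > 0)"
      using p(2) unfolding stable_above_def by blast
    then have "Im v < 0" using that by (metis add_pos_nonneg fun_upd_apply linorder_not_less plus_complex.simps(2))
    then have "Im (p \<zeta> / slope w p \<zeta>) > 0" by (simp add: v_def)
    then show ?thesis by (simp add: Im_complex_div_gt_0)
  qed simp
  define Z where "Z = (\<lambda>(t::real) k. \<zeta> k + \<i> * of_real t)"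
  define g where "g = (\<lambda>t. Im (p (Z t) * cnj (slope w p (Z t))))"
  have Z: "continuous_on UNIV Z"
    unfolding Z_def by (intro continuous_intros continuous_on_coordinatewise_then_product)
  have "continuous_on UNIV g"
    unfolding g_def
    by (intro continuous_intros continuous_on_compose2[OF p(3) Z]
        continuous_on_compose2[OF continuous_on_slope[OF p(3)] Z]) auto
  then have "(g \<longlongrightarrow> g 0) (at_right 0)"
    by (meson UNIV_I continuous_on_def filterlim_at_split tendsto_within_subset subset_UNIV continuous_on_eq_continuous_within continuous_within)
  moreover have "\<forall>\<^sub>F t in at_right 0. g t \<ge> 0"
    unfolding eventually_at_right_field g_def
    using \<zeta> by (intro exI[of _ 1] allI impI conjI strict) (auto simp: Z_def intro!: add_nonneg_pos)
  ultimately have "g 0 \<ge> 0"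
    by (rule tendsto_lowerbound) simp
  then show ?thesis by (simp add: g_def Z_def)
qed

section \<open>The barrier argument\<close>

text \<open>Two functions are related because conjugation turns the polynomial at parameter x into
  the one at the conjugate of x. The diagonal case \<open>conj_rel p p\<close> means real
  coefficients.\<close>

definition conj_rel :: "(('k \<Rightarrow> complex) \<Rightarrow> complex) \<Rightarrow> (('k \<Rightarrow> complex) \<Rightarrow> complex) \<Rightarrow> bool" where
  "conj_rel p q \<longleftrightarrow> (\<forall>\<zeta>. p (\<lambda>k. cnj (\<zeta> k)) = cnj (q \<zeta>))"

definition re_fun :: "(('k \<Rightarrow> complex) \<Rightarrow> complex) \<Rightarrow> ('k \<Rightarrow> real) \<Rightarrow> real" where
  "re_fun p \<rho> = Re (p (\<lambda>k. of_real (\<rho> k)))"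

lemma of_real_upd: "(\<lambda>k. complex_of_real (\<rho> k))(a := of_real v) = (\<lambda>k. of_real ((\<rho>(a := v)) k))"
  by (auto simp: fun_eq_iff)

lemma re_fun_slope: "re_fun (slope a p) = slope a (re_fun p)"
proof
  fix \<rho>
  show "re_fun (slope a p) \<rho> = slope a (re_fun p) \<rho>"
    using of_real_upd[of \<rho> a 0] of_real_upd[of \<rho> a 1] by (simp only: re_fun_def slope_def of_real_0 of_real_1 minus_complex.simps)
qed

lemma re_fun_lieb_sokal: "re_fun (lieb_sokal (of_real s) a b p) = lieb_sokal s a b (re_fun p)"
proof -
  have "re_fun (lieb_sokal (of_real s) a b p) \<rho> = re_fun p \<rho> - s * re_fun (slope a (slope b p)) \<rho>" for \<rho>
    by (simp add: re_fun_def lieb_sokal_def)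
  then show ?thesis by (simp add: fun_eq_iff lieb_sokal_def re_fun_slope)
qed

lemma multiaffine_re_fun:
  assumes "multiaffine p" shows "multiaffine (re_fun p)"
  unfolding multiaffine_def
proof (intro allI)
  fix a \<rho> v
  have "re_fun p (\<rho>(a := v)) = Re (p ((\<lambda>k. complex_of_real (\<rho> k))(a := of_real v)))"
    by (simp only: re_fun_def of_real_upd)
  also have "\<dots> = re_fun p \<rho> + (v - \<rho> a) * re_fun (slope a p) \<rho>"
    unfolding multiaffineD[OF assms] by (simp add: re_fun_def)
  finally show "re_fun p (\<rho>(a := v)) = re_fun p \<rho> + (v - \<rho> a) * slope a (re_fun p) \<rho>"
    by (simp add: re_fun_slope)
qed

lemma cnj_fun_upd: "(\<lambda>k. cnj ((\<zeta>(a := v)) k)) = (\<lambda>k. cnj (\<zeta> k))(a := cnj v)"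
  by (auto simp: fun_eq_iff)

lemma conj_rel_slope: assumes "conj_rel p q" shows "conj_rel (slope a p) (slope a q)"
proof -
  have "p ((\<lambda>k. cnj (\<zeta> k))(a := cnj v)) = cnj (q (\<zeta>(a := v)))" for \<zeta> v
    using assms unfolding conj_rel_def cnj_fun_upd[symmetric] by blast
  from this[of _ 0] this[of _ 1] show ?thesis
    by (simp add: conj_rel_def slope_def)
qed

lemma conj_rel_lieb_sokal:
  assumes "conj_rel p q"
  shows "conj_rel (lieb_sokal (of_real s) a b p) (lieb_sokal (of_real s) a b q)"
  using assms conj_rel_slope[OF conj_rel_slope[OF assms]] by (simp add: conj_rel_def lieb_sokal_def)

lemma conj_rel_re_fun:
  assumes "conj_rel p p"
  shows "p (\<lambda>k. of_real (\<rho> k)) = of_real (re_fun p \<rho>)"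
proof -
  have "cnj (p (\<lambda>k. of_real (\<rho> k))) = p (\<lambda>k. of_real (\<rho> k))"
    using assms[unfolded conj_rel_def, rule_format, of "\<lambda>k. of_real (\<rho> k)"] by simp
  then show ?thesis by (simp add: re_fun_def complex_eq_iff)
qed

text \<open>The first property says that
  every logarithmic derivative of \<open>f\<close> is decreasing in each coordinate; the second one is the
  nonnegativity of the Bezout form of \<open>t \<mapsto> f (\<rho> + t (e\<^sub>a + e\<^sub>b))\<close> and its \<open>w\<close>-derivative.\<close>

definition rayleigh :: "(('k \<Rightarrow> real) \<Rightarrow> real) \<Rightarrow> bool" where
  "rayleigh f \<longleftrightarrow> (\<forall>\<rho> a w. f \<rho> * slope a (slope w f) \<rho> \<le> slope a f \<rho> * slope w f \<rho>)"

text \<open>For P = A + B t + D t^2 and Q = A' + B' t + D' t^2, the quotient (P(t) Q(s) - P(s) Q(t))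
  / (t - s) is a symmetric form with a 2 by 2 matrix; the conditions are its diagonal entries and
  its determinant being nonnegative.\<close>

definition bezout_nonneg :: "real \<Rightarrow> real \<Rightarrow> real \<Rightarrow> real \<Rightarrow> real \<Rightarrow> real \<Rightarrow> bool" where
  "bezout_nonneg A B D A' B' D' \<longleftrightarrow>
     B * A' - A * B' \<ge> 0 \<and> D * B' - B * D' \<ge> 0 \<and>
     (D * A' - A * D')\<^sup>2 \<le> (B * A' - A * B') * (D * B' - B * D')"

definition diag_bezout :: "(('k \<Rightarrow> real) \<Rightarrow> real) \<Rightarrow> bool" where
  "diag_bezout f \<longleftrightarrow> (\<forall>\<rho> a b w. distinct [a, b, w] \<longrightarrow>
     bezout_nonneg (f \<rho>) (slope a f \<rho> + slope b f \<rho>) (slope a (slope b f) \<rho>)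
       (slope w f \<rho>) (slope a (slope w f) \<rho> + slope b (slope w f) \<rho>) (slope a (slope b (slope w f)) \<rho>))"

text \<open>Evaluate \<open>stable_Im_nonneg\<close> at a real point with coordinate
  \<open>a\<close> raised by \<i>: the imaginary part there is the difference of the two
  sides.\<close>

lemma stable_rayleigh:
  assumes p: "multiaffine p" "stable_above 0 p" "continuous_on UNIV p" "conj_rel p p"
  shows "rayleigh (re_fun p)"
  unfolding rayleigh_def
proof (intro allI)
  fix \<rho> :: "'a \<Rightarrow> real" and a w :: 'a
  define \<zeta> where "\<zeta> = (\<lambda>k. complex_of_real (\<rho> k))"
  have "Im (p (\<zeta>(a := \<zeta> a + \<i>)) * cnj (slope w p (\<zeta>(a := \<zeta> a + \<i>)))) \<ge> 0"
    by (rule stable_Im_nonneg[OF p(1-3)]) (simp add: \<zeta>_def)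
  then show "re_fun p \<rho> * slope a (slope w (re_fun p)) \<rho> \<le> slope a (re_fun p) \<rho> * slope w (re_fun p) \<rho>"
    unfolding multiaffineD[OF p(1)] multiaffineD[OF multiaffine_slope[OF p(1)]]
    by (simp add: \<zeta>_def conj_rel_re_fun conj_rel_slope p(4) re_fun_slope)
qed

text \<open>Letting h tend to 0 leaves a real quadratic in r that is nonnegative everywhere; the
  conclusions are the positive semidefiniteness of its matrix.\<close>

lemma quadratic_nonneg_imp:
  fixes \<alpha> \<beta> \<gamma> :: real
  assumes "\<And>r h. h > 0 \<Longrightarrow> \<alpha> + 2 * r * \<beta> + (r\<^sup>2 + h\<^sup>2) * \<gamma> \<ge> 0"
  shows "\<alpha> \<ge> 0" "\<gamma> \<ge> 0" "\<beta>\<^sup>2 \<le> \<alpha> * \<gamma>"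
proof -
  have q: "\<alpha> + 2 * r * \<beta> + r\<^sup>2 * \<gamma> \<ge> 0" for r
  proof -
    have "((\<lambda>h. \<alpha> + 2 * r * \<beta> + (r\<^sup>2 + h\<^sup>2) * \<gamma>) \<longlongrightarrow> \<alpha> + 2 * r * \<beta> + (r\<^sup>2 + 0\<^sup>2) * \<gamma>) (at_right 0)"
      by (intro tendsto_intros)
    moreover have "\<forall>\<^sub>F h in at_right 0. \<alpha> + 2 * r * \<beta> + (r\<^sup>2 + h\<^sup>2) * \<gamma> \<ge> 0"
      unfolding eventually_at_right_field using assms by (intro exI[of _ 1]) auto
    ultimately have "\<alpha> + 2 * r * \<beta> + (r\<^sup>2 + 0\<^sup>2) * \<gamma> \<ge> 0"
      by (rule tendsto_lowerbound) simp
    then show ?thesis by simp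
  qed
  show a: "\<alpha> \<ge> 0" using q[of 0] by simp
  show g: "\<gamma> \<ge> 0"
  proof (rule ccontr)
    assume "\<not> \<gamma> \<ge> 0"
    then have n: "\<gamma> < 0" by simp
    have "\<alpha> + r\<^sup>2 * \<gamma> \<ge> 0" for r
      using q[of r] q[of "-r"] by simp
    from this[of "sqrt ((\<alpha> + 1) / - \<gamma>)"] show False
      using n a by (simp add: field_simps)
  qed
  show "\<beta>\<^sup>2 \<le> \<alpha> * \<gamma>"
  proof (cases "\<gamma> = 0")
    case True
    have "\<beta> = 0"
    proof (rule ccontr)
      assume "\<beta> \<noteq> 0"
      with q[of "- (\<alpha> + 1) / (2 * \<beta>)"] True show False by (simp add: field_simps)
    qed
    with True show ?thesis by simp
  next
    case False
    with g have "\<gamma> > 0" by simp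
    with q[of "- \<beta> / \<gamma>"] show ?thesis by (simp add: field_simps power2_eq_square)
  qed
qed

text \<open>This is the Bezout form evaluated at t and its conjugate, whose sum is 2 r, whose
  product is r^2 + h^2, and whose difference is 2 \<i> h.\<close>

lemma Im_quadratic_product:
  fixes A B D A' B' D' r h :: real and t :: complex
  defines "t \<equiv> Complex r h"
  shows "Im ((A + B * t + D * t\<^sup>2) * cnj (A' + B' * t + D' * t\<^sup>2)) =
    h * ((B * A' - A * B') + 2 * r * (D * A' - A * D') + (r\<^sup>2 + h\<^sup>2) * (D * B' - B * D'))"
proof -
  have t2: "Re (t\<^sup>2) = r\<^sup>2 - h\<^sup>2" "Im (t\<^sup>2) = 2 * r * h"
    by (simp_all add: t_def power2_eq_square)
  have "Im ((A + B * t + D * t\<^sup>2) * cnj (A' + B' * t + D' * t\<^sup>2)) =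
      (B * h + D * (2 * r * h)) * (A' + B' * r + D' * (r\<^sup>2 - h\<^sup>2))
      + (A + B * r + D * (r\<^sup>2 - h\<^sup>2)) * (- (B' * h) - D' * (2 * r * h))"
    using t2 by (simp add: t_def del: complex_cnj_power)
  also have "\<dots> = h * ((B * A' - A * B') + 2 * r * (D * A' - A * D') + (r\<^sup>2 + h\<^sup>2) * (D * B' - B * D'))"
    by algebra
  finally show ?thesis .
qed

text \<open>Raising \<open>a\<close> and \<open>b\<close> by the same t in the upper half plane
  turns p and its \<open>w\<close>-slope into real quadratics in t, and
  \<open>stable_Im_nonneg\<close> holds for every such t.\<close>

lemma stable_diag_bezout:
  assumes p: "multiaffine p" "stable_above 0 p" "continuous_on UNIV p" "conj_rel p p"
  shows "diag_bezout (re_fun p)"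
  unfolding diag_bezout_def
proof (intro allI impI)
  fix \<rho> :: "'a \<Rightarrow> real" and a b w :: 'a
  assume dist: "distinct [a, b, w]"
  define \<zeta> where "\<zeta> = (\<lambda>k. complex_of_real (\<rho> k))"
  define f where "f = re_fun p"
  define A B D where "A = f \<rho>" and "B = slope a f \<rho> + slope b f \<rho>" and "D = slope a (slope b f) \<rho>"
  define A' B' D' where "A' = slope w f \<rho>" and "B' = slope a (slope w f) \<rho> + slope b (slope w f) \<rho>"
    and "D' = slope a (slope b (slope w f)) \<rho>"
  have "(B * A' - A * B') + 2 * r * (D * A' - A * D') + (r\<^sup>2 + h\<^sup>2) * (D * B' - B * D') \<ge> 0"
    if "h > 0" for r h
  proof -
    define t where "t = Complex r h"
    define Z where "Z = \<zeta>(a := \<zeta> a + t, b := \<zeta> b + t)"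
    have "p Z = A + B * t + D * t\<^sup>2"
      using dist unfolding Z_def
      by (subst multiaffine_upd2[OF p(1)])
        (auto simp: A_def B_def D_def f_def \<zeta>_def conj_rel_re_fun conj_rel_slope p(4) re_fun_slope
          power2_eq_square algebra_simps)
    moreover have "slope w p Z = A' + B' * t + D' * t\<^sup>2"
      using dist unfolding Z_def
      by (subst multiaffine_upd2[OF multiaffine_slope[OF p(1)]])
        (auto simp: A'_def B'_def D'_def f_def \<zeta>_def conj_rel_re_fun conj_rel_slope p(4) re_fun_slope
          power2_eq_square algebra_simps)
    moreover have "Im (p Z * cnj (slope w p Z)) \<ge> 0"
      by (rule stable_Im_nonneg[OF p(1-3)]) (use that in \<open>auto simp: Z_def \<zeta>_def t_def\<close>)
    ultimately have "Im ((A + B * t + D * t\<^sup>2) * cnj (A' + B' * t + D' * t\<^sup>2)) \<ge> 0"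
      by (simp only:)
    then show ?thesis
      using that unfolding t_def Im_quadratic_product by (simp add: zero_le_mult_iff)
  qed
  from quadratic_nonneg_imp[OF this]
  show "bezout_nonneg (f \<rho>) (slope a f \<rho> + slope b f \<rho>) (slope a (slope b f) \<rho>) (slope w f \<rho>)
     (slope a (slope w f) \<rho> + slope b (slope w f) \<rho>) (slope a (slope b (slope w f)) \<rho>)"
    unfolding bezout_nonneg_def A_def B_def D_def A'_def B'_def D'_def by blast
qed

section \<open>Moving the barrier point upwards\<close>

definition upper_cone :: "('k \<Rightarrow> real) \<Rightarrow> ('k \<Rightarrow> real) set" where
  "upper_cone r = {\<rho>. (\<forall>k. r k \<le> \<rho> k) \<and> finite {k. \<rho> k \<noteq> r k}}"

lemma upper_cone_refl [simp]: "r \<in> upper_cone r"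
  by (simp add: upper_cone_def)

lemma upper_cone_upd:
  assumes "\<rho> \<in> upper_cone r" "v \<ge> r k" shows "\<rho>(k := v) \<in> upper_cone r"
proof -
  have "{j. (\<rho>(k := v)) j \<noteq> r j} \<subseteq> insert k {j. \<rho> j \<noteq> r j}" by auto
  then have "finite {j. (\<rho>(k := v)) j \<noteq> r j}"
    by (rule finite_subset) (use assms in \<open>simp add: upper_cone_def\<close>)
  then show ?thesis using assms by (simp add: upper_cone_def)
qed

lemma upper_cone_trans:
  assumes "\<rho> \<in> upper_cone r'" "r' \<in> upper_cone r" shows "\<rho> \<in> upper_cone r"
proof -
  have "{k. \<rho> k \<noteq> r k} \<subseteq> {k. \<rho> k \<noteq> r' k} \<union> {k. r' k \<noteq> r k}" by auto
  then have "finite {k. \<rho> k \<noteq> r k}"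
    by (rule finite_subset) (use assms in \<open>simp add: upper_cone_def\<close>)
  moreover have "r k \<le> \<rho> k" for k
    using assms order_trans[of "r k" "r' k" "\<rho> k"] by (simp add: upper_cone_def)
  ultimately show ?thesis by (simp add: upper_cone_def)
qed

text \<open>The finiteness condition in \<open>upper_cone\<close> makes every point reachable by
  raising finitely many coordinates one at a time, whatever the index type.\<close>

lemma upper_cone_mono_induct [consumes 1, case_names base step]:
  assumes "\<rho> \<in> upper_cone r" "P r"
    and step: "\<And>\<rho> k h. \<rho> \<in> upper_cone r \<Longrightarrow> P \<rho> \<Longrightarrow> h \<ge> 0 \<Longrightarrow> P (\<rho>(k := \<rho> k + h))"
  shows "P \<rho>"
proof -
  have "\<forall>\<rho>. (\<forall>k. r k \<le> \<rho> k) \<longrightarrow> {k. \<rho> k \<noteq> r k} \<subseteq> V \<longrightarrow> P \<rho>" if "finite V" for V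
    using that
  proof (induction V)
    case empty
    show ?case
    proof (intro allI impI)
      fix \<rho> assume "{k. \<rho> k \<noteq> r k} \<subseteq> {}"
      then have "\<rho> = r" by auto
      then show "P \<rho>" using \<open>P r\<close> by simp
    qed
  next
    case (insert k V)
    show ?case
    proof (intro allI impI)
      fix \<rho> assume \<rho>: "\<forall>k. r k \<le> \<rho> k" "{k. \<rho> k \<noteq> r k} \<subseteq> insert k V"
      let ?\<rho> = "\<rho>(k := r k)"
      have V: "{j. ?\<rho> j \<noteq> r j} \<subseteq> V" and ge: "\<forall>j. r j \<le> ?\<rho> j" using \<rho> by auto
      then have "P ?\<rho>" using insert.IH by blast
      moreover have "?\<rho> \<in> upper_cone r"
        using V ge finite_subset[OF V insert.hyps(1)] by (simp add: upper_cone_def)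
      ultimately have "P (?\<rho>(k := ?\<rho> k + (\<rho> k - r k)))"
        using \<rho> by (intro step) auto
      then show "P \<rho>" by simp
    qed
  qed
  then show ?thesis using assms(1) by (auto simp: upper_cone_def)
qed

lemma affine_pos_imp_slope_nonneg:
  fixes c d :: real
  assumes "\<And>h. h \<ge> 0 \<Longrightarrow> c + h * d > 0"
  shows "d \<ge> 0"
proof (rule ccontr)
  assume "\<not> d \<ge> 0"
  then have "c + (\<bar>c\<bar> / - d) * d \<le> 0" "\<bar>c\<bar> / - d \<ge> 0" by (auto simp: field_simps)
  with assms show False by (meson not_le)
qed

lemma slope_nonneg_above:
  fixes f :: "('k \<Rightarrow> real) \<Rightarrow> real"
  assumes "multiaffine f" "\<And>\<rho>. \<rho> \<in> upper_cone r \<Longrightarrow> f \<rho> > 0" "\<rho> \<in> upper_cone r"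
  shows "slope a f \<rho> \<ge> 0"
proof (rule affine_pos_imp_slope_nonneg)
  fix h :: real assume "h \<ge> 0"
  then have "\<rho>(a := \<rho> a + h) \<in> upper_cone r"
    using assms(3) by (intro upper_cone_upd) (auto simp: upper_cone_def intro: add_increasing2)
  from assms(2)[OF this] show "f \<rho> + h * slope a f \<rho> > 0"
    by (simp add: multiaffineD[OF assms(1)])
qed

text \<open>When coordinate k is raised, the Rayleigh inequality and the nonnegative k-slope of f
  carry the bound from f and its \<open>w\<close>-slope over to their k-slopes. Both sides are
  affine in that coordinate, so the bound persists.\<close>

lemma log_derivative_antimono:
  fixes f :: "('k \<Rightarrow> real) \<Rightarrow> real"
  assumes f: "multiaffine f" "rayleigh f" and pos: "\<And>\<rho>. \<rho> \<in> upper_cone r \<Longrightarrow> f \<rho> > 0"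
    and "slope w f r \<le> \<phi> * f r" "\<rho> \<in> upper_cone r"
  shows "slope w f \<rho> \<le> \<phi> * f \<rho>"
  using assms(5)
proof (induction rule: upper_cone_mono_induct)
  case base
  then show ?case by fact
next
  case (step \<rho> k h)
  let ?F = "f \<rho>" and ?K = "slope k f \<rho>" and ?G = "slope w f \<rho>" and ?L = "slope k (slope w f) \<rho>"
  have F: "?F > 0" using pos step by blast
  have K: "?K \<ge> 0" using slope_nonneg_above[OF f(1) pos step(1)] .
  have "?F * ?L \<le> ?K * ?G" using f(2) by (simp add: rayleigh_def)
  also have "\<dots> \<le> ?K * (\<phi> * ?F)" using step K by (intro mult_left_mono)
  finally have "?F * ?L \<le> ?F * (\<phi> * ?K)" by (simp add: algebra_simps)
  then have "?L \<le> \<phi> * ?K" using F by simp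
  then have "h * ?L \<le> h * (\<phi> * ?K)" using step by (intro mult_left_mono) auto
  then show ?case
    using step unfolding multiaffineD[OF f(1)] multiaffineD[OF multiaffine_slope[OF f(1)]]
    by (simp add: algebra_simps)
qed

text \<open>The unprimed letters are the coefficients of f along the diagonal through the raised
  point, the primed ones those of its \<open>w\<close>-slope; t = - \<delta> is the old point.
  Cross-multiplied, the claim is that the logarithmic derivative after the operator at the raised
  point is at most the one before it at the old point.\<close>

lemma barrier_shift_ineq:
  fixes A B D A' B' D' s \<delta> :: real
  assumes bez: "bezout_nonneg A B D A' B' D'"
    and pos: "\<And>t. t \<ge> -\<delta> \<Longrightarrow> A + B * t + D * t\<^sup>2 > 0"
    and "D \<ge> 0" "s \<ge> 0" "\<delta> \<ge> 0" "s * B \<le> \<delta> * A"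
  shows "(A' - s * D') * (A - B * \<delta> + D * \<delta>\<^sup>2) \<le> (A' - B' * \<delta> + D' * \<delta>\<^sup>2) * (A - s * D)"
proof -
  define \<alpha> \<beta> \<gamma> where "\<alpha> = B * A' - A * B'" and "\<beta> = D * A' - A * D'" and "\<gamma> = D * B' - B * D'"
  have \<alpha>: "\<alpha> \<ge> 0" and \<gamma>: "\<gamma> \<ge> 0" and \<beta>2: "\<beta>\<^sup>2 \<le> \<alpha> * \<gamma>"
    using bez by (auto simp: bezout_nonneg_def \<alpha>_def \<beta>_def \<gamma>_def)
  \<comment> \<open>The linear relation between the maximal minors of the 2 by 3 matrix of
    coefficients.\<close>
  have syzygy: "A * \<gamma> = B * \<beta> - D * \<alpha>" by (simp add: \<alpha>_def \<beta>_def \<gamma>_def algebra_simps)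
  have "A > 0" using pos[of 0] \<open>\<delta> \<ge> 0\<close> by simp
  have key: "(\<delta>\<^sup>2 + s) * \<beta> \<le> \<delta> * \<alpha> + s * \<delta> * \<gamma>"
  proof (cases "\<beta> \<le> 0")
    case True
    then have "(\<delta>\<^sup>2 + s) * \<beta> \<le> 0" using \<open>s \<ge> 0\<close> by (simp add: mult_nonneg_nonpos)
    also have "0 \<le> \<delta> * \<alpha> + s * \<delta> * \<gamma>" using \<alpha> \<gamma> \<open>s \<ge> 0\<close> \<open>\<delta> \<ge> 0\<close> by simp
    finally show ?thesis .
  next
    case False
    then have "\<beta> > 0" by simp
    (* - x lies between the roots of A + B t + D t^2, which are all below - \<delta> *)
    define x where "x = \<alpha> / \<beta>"
    have "\<alpha> \<noteq> 0" using \<beta>2 \<open>\<beta> > 0\<close> by auto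
    then have "x > 0" using \<alpha> \<open>\<beta> > 0\<close> by (simp add: x_def)
    have \<alpha>x: "\<alpha> = x * \<beta>" using \<open>\<beta> > 0\<close> by (simp add: x_def)
    have "\<beta> * \<beta> \<le> \<beta> * (x * \<gamma>)" using \<beta>2 by (simp add: \<alpha>x power2_eq_square algebra_simps)
    then have \<gamma>x: "\<beta> \<le> x * \<gamma>" using \<open>\<beta> > 0\<close> by simp
    have "A * \<beta> \<le> A * (x * \<gamma>)" using \<gamma>x \<open>A > 0\<close> by simp
    also have "\<dots> = x * (B * \<beta> - D * \<alpha>)" by (simp add: syzygy[symmetric])
    also have "\<dots> = (B * x - D * x\<^sup>2) * \<beta>" by (simp add: \<alpha>x power2_eq_square algebra_simps)
    finally have Ax: "A \<le> B * x - D * x\<^sup>2" using \<open>\<beta> > 0\<close> by simp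
    have "x > \<delta>"
    proof (rule ccontr)
      assume "\<not> x > \<delta>"
      with pos[of "-x"] Ax show False by simp
    qed
    have ABx: "A \<le> B * x" using Ax \<open>D \<ge> 0\<close> by (smt (verit) mult_nonneg_nonneg zero_le_power2)
    with \<open>A > 0\<close> have "B * x > 0" by linarith
    then have "B > 0" using \<open>x > 0\<close> by (simp add: zero_less_mult_iff)
    have "B * s \<le> B * (\<delta> * x)"
      using \<open>s * B \<le> \<delta> * A\<close> mult_left_mono[OF ABx \<open>\<delta> \<ge> 0\<close>] by (simp add: algebra_simps)
    then have "s \<le> \<delta> * x" using \<open>B > 0\<close> by simp
    \<comment> \<open>The crux: this product expands to \<delta> x^2 + s \<delta> - (\<delta>^2 + s)
      x, the desired inequality up to positive factors once \<alpha> = x \<beta> and \<beta> \<le> x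
      \<gamma> are used.\<close>
    then have "(x - \<delta>) * (\<delta> * x - s) \<ge> 0" using \<open>x > \<delta>\<close> by simp
    then have "(\<delta>\<^sup>2 + s) * x * \<beta> \<le> (\<delta> * x * x + s * \<delta>) * \<beta>"
      using \<open>\<beta> > 0\<close> by (intro mult_right_mono) (auto simp: algebra_simps power2_eq_square)
    also have "\<dots> \<le> \<delta> * x * x * \<beta> + s * \<delta> * (x * \<gamma>)"
      using mult_left_mono[OF \<gamma>x, of "s * \<delta>"] \<open>s \<ge> 0\<close> \<open>\<delta> \<ge> 0\<close> by (simp add: algebra_simps)
    finally have "x * ((\<delta>\<^sup>2 + s) * \<beta>) \<le> x * (\<delta> * \<alpha> + s * \<delta> * \<gamma>)"
      by (simp add: \<alpha>x algebra_simps)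
    then show ?thesis using \<open>x > 0\<close> by simp
  qed
  have "(A' - B' * \<delta> + D' * \<delta>\<^sup>2) * (A - s * D) - (A' - s * D') * (A - B * \<delta> + D * \<delta>\<^sup>2) =
      \<delta> * \<alpha> + s * \<delta> * \<gamma> - (\<delta>\<^sup>2 + s) * \<beta>"
    by (simp add: \<alpha>_def \<beta>_def \<gamma>_def algebra_simps power2_eq_square)
  with key show ?thesis by linarith
qed

text \<open>Positivity needs no shift beyond the old cone: the Rayleigh inequality bounds the mixed
  slope by \<phi>^2 f, and s \<phi>^2 < 1. The shift by \<delta> serves the second claim, that the
  barrier bounds in the other coordinates survive the operator.\<close>

lemma barrier_step:
  fixes f :: "('k \<Rightarrow> real) \<Rightarrow> real"
  assumes f: "multiaffine f" "rayleigh f" "diag_bezout f"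
    and pos: "\<And>\<rho>. \<rho> \<in> upper_cone r \<Longrightarrow> f \<rho> > 0"
    and ab: "a \<noteq> b" "slope a f r \<le> \<phi> * f r" "slope b f r \<le> \<phi> * f r"
    and s: "s \<ge> 0" "\<delta> \<ge> 0" "\<phi> \<ge> 0" "s * (2 * \<phi>) \<le> \<delta>" "s * \<phi>\<^sup>2 < 1"
    and r': "r' = r(a := r a + \<delta>, b := r b + \<delta>)"
  shows "\<And>\<rho>. \<rho> \<in> upper_cone r' \<Longrightarrow> lieb_sokal s a b f \<rho> > 0"
    and "\<And>w \<psi>. w \<notin> {a, b} \<Longrightarrow> slope w f r \<le> \<psi> * f r \<Longrightarrow>
      slope w (lieb_sokal s a b f) r' \<le> \<psi> * lieb_sokal s a b f r'"
proof -
  have r'r: "r' \<in> upper_cone r"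
    unfolding r' using \<open>\<delta> \<ge> 0\<close> by (intro upper_cone_upd) auto
  show pos': "lieb_sokal s a b f \<rho> > 0" if "\<rho> \<in> upper_cone r'" for \<rho>
  proof -
    have \<rho>: "\<rho> \<in> upper_cone r" using upper_cone_trans[OF that r'r] .
    have F: "f \<rho> > 0" using pos \<rho> by blast
    have "f \<rho> * slope a (slope b f) \<rho> \<le> slope a f \<rho> * slope b f \<rho>" using f(2) by (simp add: rayleigh_def)
    also have "\<dots> \<le> (\<phi> * f \<rho>) * (\<phi> * f \<rho>)"
      using log_derivative_antimono[OF f(1,2) pos ab(2) \<rho>] log_derivative_antimono[OF f(1,2) pos ab(3) \<rho>]
        slope_nonneg_above[OF f(1) pos \<rho>] F \<open>\<phi> \<ge> 0\<close> by (intro mult_mono) auto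
    finally have "f \<rho> * slope a (slope b f) \<rho> \<le> f \<rho> * (\<phi>\<^sup>2 * f \<rho>)" by (simp add: power2_eq_square algebra_simps)
    then have "slope a (slope b f) \<rho> \<le> \<phi>\<^sup>2 * f \<rho>" using F by simp
    then have "s * slope a (slope b f) \<rho> \<le> s * (\<phi>\<^sup>2 * f \<rho>)" using s(1) by (rule mult_left_mono)
    also have "\<dots> < f \<rho>" using F s(5) mult_strict_right_mono[OF s(5) F] by simp
    finally show ?thesis by (simp add: lieb_sokal_def)
  qed
  fix w \<psi> assume w: "w \<notin> {a, b}" and \<psi>: "slope w f r \<le> \<psi> * f r"
  \<comment> \<open>All coefficients are taken at the raised point \<open>r'\<close>, so that the
    old point is t = - \<delta> on the diagonal.\<close>
  define A B D where "A = f r'" and "B = slope a f r' + slope b f r'" and "D = slope a (slope b f) r'"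
  define A' B' D' where "A' = slope w f r'" and "B' = slope a (slope w f) r' + slope b (slope w f) r'"
    and "D' = slope a (slope b (slope w f)) r'"
  have P: "f (r'(a := r' a + t, b := r' b + t)) = A + B * t + D * t\<^sup>2" for t
    unfolding A_def B_def D_def
    by (subst multiaffine_upd2[OF f(1) ab(1)]) (simp add: algebra_simps power2_eq_square)
  have Q: "slope w f (r'(a := r' a + t, b := r' b + t)) = A' + B' * t + D' * t\<^sup>2" for t
    unfolding A'_def B'_def D'_def
    by (subst multiaffine_upd2[OF multiaffine_slope[OF f(1)] ab(1)]) (simp add: algebra_simps power2_eq_square)
  have r: "r'(a := r' a + - \<delta>, b := r' b + - \<delta>) = r"
    using ab(1) by (auto simp: r' fun_eq_iff)
  have "bezout_nonneg A B D A' B' D'"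
    using f(3) w ab(1) unfolding diag_bezout_def A_def B_def D_def A'_def B'_def D'_def by auto
  moreover have "A + B * t + D * t\<^sup>2 > 0" if "t \<ge> -\<delta>" for t
    unfolding P[symmetric] using that ab(1) by (intro pos upper_cone_upd r'r) (auto simp: r')
  moreover have "D \<ge> 0"
  proof -
    have "slope a f r' + h * slope b (slope a f) r' \<ge> 0" if "h \<ge> 0" for h
    proof -
      have "r'(b := r' b + h) \<in> upper_cone r"
        using that \<open>\<delta> \<ge> 0\<close> ab(1) by (intro upper_cone_upd r'r) (auto simp: r')
      from slope_nonneg_above[OF f(1) pos this, of a] show ?thesis
        by (simp add: multiaffineD[OF multiaffine_slope[OF f(1)]])
    qed
    \<comment> \<open>The added 1 supplies the strict positivity that
      \<open>affine_pos_imp_slope_nonneg\<close> asks for.\<close>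
    then have "(slope a f r' + 1) + h * slope b (slope a f) r' > 0" if "h \<ge> 0" for h
      using that by (smt (verit))
    from affine_pos_imp_slope_nonneg[OF this] show ?thesis
      by (simp add: D_def) (metis slope_commute)
  qed
  \<comment> \<open>\<open>B\<close> is the sum of two slopes, each at most \<phi> A; this is where
    the factor 2 in s (2 \<phi>) \<le> \<delta> comes from.\<close>
  moreover have "s * B \<le> \<delta> * A"
  proof -
    have "B \<le> (2 * \<phi>) * A"
      using log_derivative_antimono[OF f(1,2) pos ab(2) r'r] log_derivative_antimono[OF f(1,2) pos ab(3) r'r]
      by (simp add: A_def B_def)
    then have "s * B \<le> s * ((2 * \<phi>) * A)" using s(1) by (rule mult_left_mono)
    also have "\<dots> \<le> \<delta> * A"
      using mult_right_mono[OF s(4), of A] pos[OF r'r] by (simp add: A_def)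
    finally show ?thesis .
  qed
  ultimately have "(A' - s * D') * (A - B * \<delta> + D * \<delta>\<^sup>2) \<le> (A' - B' * \<delta> + D' * \<delta>\<^sup>2) * (A - s * D)"
    using s by (intro barrier_shift_ineq)
  then have "(A' - s * D') * f r \<le> slope w f r * (A - s * D)"
    using P[of "-\<delta>"] Q[of "-\<delta>"] unfolding r by simp
  also have "\<dots> \<le> (\<psi> * f r) * (A - s * D)"
    using \<psi> pos'[of r'] by (intro mult_right_mono) (auto simp: lieb_sokal_def A_def D_def)
  finally have "A' - s * D' \<le> \<psi> * (A - s * D)"
    using pos[of r] by (simp add: mult.commute mult.left_commute)
  then show "slope w (lieb_sokal s a b f) r' \<le> \<psi> * lieb_sokal s a b f r'"
    unfolding slope_lieb_sokal by (simp add: lieb_sokal_def A_def D_def A'_def D'_def)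
qed

section \<open>Determinants of rank-one pencils\<close>

definition cinner :: "complex ^ 'm \<Rightarrow> complex ^ 'm \<Rightarrow> complex" where
  "cinner v w = (\<Sum>i\<in>UNIV. cnj (v $ i) * w $ i)"

lemma norm_vec_power2: "(norm (v :: complex ^ 'm))\<^sup>2 = (\<Sum>i\<in>UNIV. (cmod (v $ i))\<^sup>2)"
  by (simp add: norm_vec_def L2_set_def sum_nonneg)

lemma cinner_self: "cinner v v = of_real ((norm v)\<^sup>2)"
  by (simp add: cinner_def norm_vec_power2 complex_norm_square mult.commute del: of_real_power)

lemma cinner_commute: "cinner w v = cnj (cinner v w)"
  by (simp add: cinner_def cnj_sum mult.commute)

lemma cinner_add_right: "cinner v (w + z) = cinner v w + cinner v z"
  by (simp add: cinner_def algebra_simps sum.distrib)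

lemma cinner_scale_right: "cinner v (c *s w) = c * cinner v w"
  by (simp add: cinner_def sum_distrib_left algebra_simps)

lemma cinner_sum_right: "cinner v (\<Sum>k\<in>I. f k) = (\<Sum>k\<in>I. cinner v (f k))"
  by (simp add: cinner_def sum_distrib_left sum.swap[of _ I])

lemma cinner_Cauchy_Schwarz: "cmod (cinner v w) \<le> norm v * norm w"
proof -
  have "cmod (cinner v w) \<le> (\<Sum>i\<in>UNIV. cmod (v $ i) * cmod (w $ i))"
    unfolding cinner_def by (rule order_trans[OF norm_sum]) (simp add: norm_mult)
  also have "\<dots> \<le> norm v * norm w"
    using L2_set_mult_ineq[of "\<lambda>i. cmod (v $ i)" "\<lambda>i. cmod (w $ i)" UNIV]
    by (simp add: norm_vec_def)
  finally show ?thesis .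
qed

text \<open>Row k is already b, so adding multiples of b to other rows is a row operation.\<close>

lemma det_row_perturb_const:
  fixes M :: "'a::comm_ring_1 ^ 'm ^ 'm" and b :: "'a ^ 'm"
  assumes "finite S" "k \<notin> S"
  shows "det (\<chi> i. if i = k then b else if i \<in> S then M $ i + c i *s b else M $ i) =
    det (\<chi> i. if i = k then b else M $ i)"
  using assms
proof (induction S)
  case (insert j S)
  let ?A = "\<chi> i. if i = k then b else if i \<in> S then M $ i + c i *s b else M $ i"
  have "(\<chi> l. if l = j then row j ?A + c j *s row k ?A else row l ?A) =
      (\<chi> i. if i = k then b else if i \<in> insert j S then M $ i + c i *s b else M $ i)"
    using insert by (auto simp: vec_eq_iff row_def)
  moreover have "det (\<chi> l. if l = j then row j ?A + c j *s row k ?A else row l ?A) = det ?A"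
    using insert by (intro det_row_operation) auto
  ultimately show ?case using insert by simp
qed (simp cong: if_cong)

text \<open>The perturbation is switched on one row at a time. When row k contributes its multiple
  of b, \<open>det_row_perturb_const\<close> removes the perturbation from all other rows, so no
  higher power of t arises.\<close>

lemma det_rank_one_affine:
  fixes M :: "'a::comm_ring_1 ^ 'm ^ 'm" and a b :: "'a ^ 'm"
  shows "\<exists>c d. \<forall>t. det (\<chi> i j. M $ i $ j + t * (a $ i * b $ j)) = c + t * d"
proof -
  have "\<exists>c d. \<forall>t. det (\<chi> i. if i \<in> S then M $ i + (t * a $ i) *s b else M $ i) = c + t * d"
    if "finite S" for S
    using that
  proof (induction S)
    case empty
    show ?case by (rule exI[of _ "det M"], rule exI[of _ 0]) simp
  next
    case (insert k S)
    define R where "R t = (\<lambda>i. if i \<in> S then M $ i + (t * a $ i) *s b else M $ i)" for t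
    obtain c d where cd: "\<And>t. det (\<chi> i. R t i) = c + t * d"
      using insert.IH unfolding R_def by blast
    define e where "e = det (\<chi> i. if i = k then b else M $ i)"
    have "det (\<chi> i. if i \<in> insert k S then M $ i + (t * a $ i) *s b else M $ i) =
        c + t * (d + a $ k * e)" for t
    proof -
      have "(\<chi> i. if i \<in> insert k S then M $ i + (t * a $ i) *s b else M $ i) =
          (\<chi> i. if i = k then M $ i + (t * a $ k) *s b else R t i)"
        by (auto simp: vec_eq_iff R_def)
      then have "det (\<chi> i. if i \<in> insert k S then M $ i + (t * a $ i) *s b else M $ i) =
          det (\<chi> i. if i = k then M $ i else R t i) +
          (t * a $ k) * det (\<chi> i. if i = k then b else R t i)"
        by (simp only: det_row_add det_row_mul)
      moreover have "(\<chi> i. if i = k then M $ i else R t i) = (\<chi> i. R t i)"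
        using insert by (auto simp: vec_eq_iff R_def)
      moreover have "det (\<chi> i. if i = k then b else R t i) = e"
        unfolding R_def e_def using insert by (intro det_row_perturb_const) auto
      ultimately show ?thesis by (simp add: cd algebra_simps)
    qed
    then show ?case by blast
  qed
  from this[of UNIV]
  obtain c d where "\<And>t. det (\<chi> i. M $ i + (t * a $ i) *s b) = c + t * d" by auto
  moreover have "(\<chi> i. M $ i + (t * a $ i) *s b) = (\<chi> i j. M $ i $ j + t * (a $ i * b $ j))" for t
    by (simp add: vec_eq_iff algebra_simps)
  ultimately show ?thesis by auto
qed

lemma det_nonzero_if_injective:
  fixes A :: "'a::field ^ 'm ^ 'm"
  assumes "\<And>v. A *v v = 0 \<Longrightarrow> v = 0"
  shows "det A \<noteq> 0"
  using assms matrix_left_invertible_ker[of A] invertible_left_inverse[of A] invertible_det_nz[of A]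
  by blast

section \<open>Nonvanishing and positivity of the determinants\<close>

definition pencil :: "nat \<Rightarrow> (nat \<Rightarrow> complex ^ 'm) \<Rightarrow> complex \<Rightarrow> (nat \<Rightarrow> complex) \<Rightarrow> complex ^ 'm ^ 'm" where
  "pencil n u x y = (\<chi> i j. (if i = j then x else 0) + (\<Sum>k=1..n. y k * (u k $ i * cnj (u k $ j))))"

definition pdet :: "nat \<Rightarrow> (nat \<Rightarrow> complex ^ 'm) \<Rightarrow> complex \<Rightarrow> (nat \<Rightarrow> complex) \<Rightarrow> complex" where
  "pdet n u x y = det (pencil n u x y)"

lemma pencil_mult_vec:
  "pencil n u x y *v v = x *s v + (\<Sum>k=1..n. (y k * cinner (u k) v) *s u k)"
proof -
  have "(\<Sum>j\<in>UNIV. (if i = j then x else 0) * v $ j) = x * v $ i" for i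
    by (simp add: if_distrib[of "\<lambda>a. a * _"] cong: if_cong)
  then show ?thesis
    by (simp add: vec_eq_iff pencil_def matrix_vector_mult_def cinner_def algebra_simps
        sum.distrib sum_distrib_left sum_distrib_right sum.swap[of _ "{Suc 0..n}"])
qed

lemma cinner_pencil:
  "cinner v (pencil n u x y *v v) =
    x * of_real ((norm v)\<^sup>2) + (\<Sum>k=1..n. y k * of_real ((cmod (cinner (u k) v))\<^sup>2))"
proof -
  have "cinner (u k) v * cinner v (u k) = of_real ((cmod (cinner (u k) v))\<^sup>2)" for k
    using complex_norm_square[of "cinner (u k) v"] cinner_commute[of v "u k"] by simp
  then show ?thesis
    by (simp add: pencil_mult_vec cinner_add_right cinner_scale_right cinner_sum_right cinner_self
        mult.assoc del: of_real_power)
qed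

lemma pdet_affine: "\<exists>c d. \<forall>t. pdet n u x (y(k := t)) = c + t * d"
proof (cases "k \<in> {1..n}")
  case True
  have perturb: "pencil n u x (y(k := t)) =
      (\<chi> i j. pencil n u x (y(k := 0)) $ i $ j + t * (u k $ i * (\<chi> j. cnj (u k $ j)) $ j))" for t
    using True by (simp add: vec_eq_iff pencil_def sum.remove[of "{1..n}" k] del: One_nat_def)
  obtain c d where "\<forall>t. det (\<chi> i j. pencil n u x (y(k := 0)) $ i $ j +
      t * (u k $ i * (\<chi> j. cnj (u k $ j)) $ j)) = c + t * d"
    using det_rank_one_affine[of "pencil n u x (y(k := 0))" "u k" "\<chi> j. cnj (u k $ j)"]
    by (elim exE) (rule that)
  then have "pdet n u x (y(k := t)) = c + t * d" for t
    unfolding pdet_def by (subst perturb) (rule spec)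
  then show ?thesis by blast
next
  case False
  then have "pencil n u x (y(k := t)) = pencil n u x y" for t
    by (auto simp: vec_eq_iff pencil_def intro!: sum.cong)
  then show ?thesis
    by (intro exI[of _ "pdet n u x y"] exI[of _ 0]) (simp add: pdet_def)
qed

lemma pdet_cnj: "pdet n u (cnj x) (\<lambda>k. cnj (y k)) = cnj (pdet n u x y)"
proof -
  have "pencil n u (cnj x) (\<lambda>k. cnj (y k)) = transpose (\<chi> i j. cnj (pencil n u x y $ i $ j))"
    by (auto simp: vec_eq_iff pencil_def transpose_def mult.commute intro!: sum.cong)
  moreover have "det (\<chi> i j. cnj (A $ i $ j)) = cnj (det A)" for A :: "complex ^ 'm ^ 'm"
    by (simp add: det_def)
  ultimately show ?thesis by (simp add: pdet_def)
qed

lemma pdet_holomorphic: "(\<lambda>x. pdet n u x y) holomorphic_on S"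
proof -
  have "(\<lambda>x. pencil n u x y $ i $ j) holomorphic_on S" for i j
    by (cases "i = j") (auto simp: pencil_def intro!: holomorphic_intros)
  then show ?thesis unfolding pdet_def det_def by (intro holomorphic_intros)
qed

lemma pdet_continuous: "continuous_on UNIV (pdet n u x)"
proof -
  have "continuous_on UNIV (\<lambda>y. pencil n u x y $ i $ j)" for i j
    by (cases "i = j") (auto simp: pencil_def intro!: continuous_intros)
  then show ?thesis unfolding pdet_def[abs_def] det_def
    by (intro continuous_on_sum continuous_on_mult continuous_on_const continuous_on_prod)
qed

text \<open>On a kernel vector the Hermitian form vanishes, yet by Cauchy-Schwarz a negative part of
  size \<eta> in the y costs at most \<eta> times the sum of squared norms, less than Im x. This
  leaves room below the real axis for the y.\<close>

lemma pdet_nonzero_complex: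
  assumes "\<And>k. Im (y k) \<ge> - \<eta>" "\<eta> \<ge> 0" "\<eta> * (\<Sum>k=1..n. (norm (u k))\<^sup>2) < Im x"
  shows "pdet n u x y \<noteq> 0"
  unfolding pdet_def
proof (rule det_nonzero_if_injective, rule ccontr)
  fix v assume "pencil n u x y *v v = 0" "v \<noteq> 0"
  then have "Im (cinner v (pencil n u x y *v v)) = 0" by (simp add: cinner_def)
  then have 0: "Im x * (norm v)\<^sup>2 + (\<Sum>k=1..n. Im (y k) * (cmod (cinner (u k) v))\<^sup>2) = 0"
    unfolding cinner_pencil by simp
  have "Im (y k) * (cmod (cinner (u k) v))\<^sup>2 \<ge> - (\<eta> * (norm (u k))\<^sup>2 * (norm v)\<^sup>2)" for k
  proof -
    have "(cmod (cinner (u k) v))\<^sup>2 \<le> (norm (u k) * norm v)\<^sup>2"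
      by (intro power_mono cinner_Cauchy_Schwarz) simp
    then have "\<eta> * (cmod (cinner (u k) v))\<^sup>2 \<le> \<eta> * ((norm (u k))\<^sup>2 * (norm v)\<^sup>2)"
      using assms(2) by (intro mult_left_mono) (auto simp: power_mult_distrib)
    moreover have "- \<eta> * (cmod (cinner (u k) v))\<^sup>2 \<le> Im (y k) * (cmod (cinner (u k) v))\<^sup>2"
      using assms(1)[of k] by (intro mult_right_mono) auto
    ultimately show ?thesis by simp
  qed
  then have "(\<Sum>k=1..n. - (\<eta> * (norm (u k))\<^sup>2 * (norm v)\<^sup>2)) \<le> (\<Sum>k=1..n. Im (y k) * (cmod (cinner (u k) v))\<^sup>2)"
    by (intro sum_mono)
  then have "(Im x - \<eta> * (\<Sum>k=1..n. (norm (u k))\<^sup>2)) * (norm v)\<^sup>2 \<le> 0"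
    using 0 by (simp add: sum_negf sum_distrib_left sum_distrib_right algebra_simps)
  moreover have "(Im x - \<eta> * (\<Sum>k=1..n. (norm (u k))\<^sup>2)) * (norm v)\<^sup>2 > 0"
    using assms(3) \<open>v \<noteq> 0\<close> by simp
  ultimately show False by linarith
qed

text \<open>For real x the imaginary part of the form only shows that a kernel vector is orthogonal
  to all \<open>u k\<close>; on such vectors the pencil acts as the nonzero scalar x.\<close>

lemma pdet_nonzero_upper:
  assumes "x > (0::real)" "\<And>k. Im (y k) > 0"
  shows "pdet n u (of_real x) y \<noteq> 0"
  unfolding pdet_def
proof (rule det_nonzero_if_injective)
  fix v assume v: "pencil n u (of_real x) y *v v = 0"
  then have "Im (cinner v (pencil n u (of_real x) y *v v)) = 0" by (simp add: cinner_def)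
  then have "(\<Sum>k=1..n. Im (y k) * (cmod (cinner (u k) v))\<^sup>2) = 0"
    unfolding cinner_pencil by simp
  then have "\<forall>k\<in>{1..n}. Im (y k) * (cmod (cinner (u k) v))\<^sup>2 = 0"
    using assms(2) by (subst (asm) sum_nonneg_eq_0_iff) (auto simp: less_imp_le)
  then have "\<forall>k\<in>{1..n}. cinner (u k) v = 0" using assms(2) by (metis less_irrefl mult_eq_0_iff norm_eq_zero power_eq_0_iff)
  then have "pencil n u (of_real x) y *v v = of_real x *s v"
    unfolding pencil_mult_vec by simp
  with v assms(1) show "v = 0" by (auto simp: vec_eq_iff)
qed

text \<open>Scale y by t from 0 to 1: the form stays positive definite as a convex combination, so
  the determinant is real, never vanishes, and starts at a power of x.\<close>

lemma pdet_pos: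
  fixes u :: "nat \<Rightarrow> complex ^ 'm"
  assumes "c > 0" "\<And>v. x * (norm v)\<^sup>2 + (\<Sum>k=1..n. y k * (cmod (cinner (u k) v))\<^sup>2) \<ge> c * (norm v)\<^sup>2"
    and "x > 0"
  shows "Re (pdet n u (of_real x) (\<lambda>k. of_real (y k))) > 0"
proof -
  define g where "g t = Re (pdet n u (of_real x) (\<lambda>k. of_real (t * y k)))" for t
  have real: "Im (pdet n u (of_real x) (\<lambda>k. of_real (t * y k))) = 0" for t
    using pdet_cnj[of n u "of_real x" "\<lambda>k. of_real (t * y k)"] by (simp add: complex_eq_iff)
  have nz: "g t \<noteq> 0" if t: "0 \<le> t" "t \<le> 1" for t
  proof -
    have "pdet n u (of_real x) (\<lambda>k. of_real (t * y k)) \<noteq> 0"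
      unfolding pdet_def
    proof (rule det_nonzero_if_injective, rule ccontr)
      fix v assume v: "pencil n u (of_real x) (\<lambda>k. of_real (t * y k)) *v v = 0" "v \<noteq> 0"
      define q where "q = (\<Sum>k=1..n. y k * (cmod (cinner (u k) v))\<^sup>2)"
      have "Re (cinner v (pencil n u (of_real x) (\<lambda>k. of_real (t * y k)) *v v)) = 0"
        using v by (simp add: cinner_def)
      then have "x * (norm v)\<^sup>2 + (\<Sum>k=1..n. t * y k * (cmod (cinner (u k) v))\<^sup>2) = 0"
        unfolding cinner_pencil by simp
      then have "x * (norm v)\<^sup>2 + t * q = 0"
        by (simp add: q_def sum_distrib_left mult.assoc)
      moreover have "x * (norm v)\<^sup>2 + t * q = (1 - t) * (x * (norm v)\<^sup>2) + t * (x * (norm v)\<^sup>2 + q)"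
        by (simp add: algebra_simps)
      moreover have "c * (norm v)\<^sup>2 > 0" using \<open>c > 0\<close> v(2) by simp
      then have "x * (norm v)\<^sup>2 + q > 0" using assms(2)[of v] unfolding q_def by linarith
      moreover have "x * (norm v)\<^sup>2 > 0" using \<open>x > 0\<close> v(2) by simp
      ultimately show False using t
        by (smt (verit) mult_nonneg_nonneg mult_pos_pos)
    qed
    then show ?thesis using real[of t] by (auto simp: g_def complex_eq_iff)
  qed
  have cont: "continuous_on {0..1} g"
    unfolding g_def
    by (intro continuous_intros continuous_on_compose2[OF pdet_continuous]
        continuous_on_coordinatewise_then_product) auto
  have "pencil n u (of_real x) (\<lambda>k. 0) = (\<chi> i j. if i = j then of_real x else 0)"
    by (auto simp: pencil_def vec_eq_iff)
  then have "g 0 = x ^ CARD('m)"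
    unfolding g_def pdet_def by (simp add: det_diagonal flip: of_real_power)
  then have "g 0 > 0" using \<open>x > 0\<close> by simp
  have "g 1 > 0"
  proof (rule ccontr)
    assume "\<not> g 1 > 0"
    then obtain t where "0 \<le> t" "t \<le> 1" "g t = 0"
      using IVT2'[of g 1 0 0] cont \<open>g 0 > 0\<close> by auto
    then show False using nz by blast
  qed
  then show ?thesis by (simp add: g_def)
qed

text \<open>The boolean tags the two copies of each variable: the \<open>False\<close> copy will
  receive the negated centred outcome, the \<open>True\<close> copy the centred outcome
  itself.\<close>

definition double_det :: "nat \<Rightarrow> (nat \<Rightarrow> complex ^ 'm) \<Rightarrow> complex \<Rightarrow> (nat \<times> bool \<Rightarrow> complex) \<Rightarrow> complex" where
  "double_det n u x \<zeta> = pdet n u x (\<lambda>i. \<zeta> (i, False)) * pdet n u x (\<lambda>i. \<zeta> (i, True))"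

lemma multiaffine_double_det: "multiaffine (double_det n u x)"
proof (rule multiaffineI)
  fix a :: "nat \<times> bool" and \<zeta> :: "nat \<times> bool \<Rightarrow> complex"
  obtain k s where a: "a = (k, s)" by (cases a)
  define y where "y = (\<lambda>i. \<zeta> (i, s))"
  define K where "K = pdet n u x (\<lambda>i. \<zeta> (i, \<not> s))"
  obtain c d where cd: "\<And>t. pdet n u x (y(k := t)) = c + t * d" using pdet_affine by metis
  have "(\<lambda>i. (\<zeta>(a := t)) (i, s)) = y(k := t)" "(\<lambda>i. (\<zeta>(a := t)) (i, \<not> s)) = (\<lambda>i. \<zeta> (i, \<not> s))" for t
    by (auto simp: a y_def)
  then have "double_det n u x (\<zeta>(a := t)) = (c + t * d) * K" for t
    unfolding double_det_def K_def using cd by (cases s) (auto simp: mult.commute)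
  then show "\<exists>c d. \<forall>t. double_det n u x (\<zeta>(a := t)) = c + t * d"
    by (intro exI[of _ "c * K"] exI[of _ "d * K"]) (simp add: algebra_simps)
qed

lemma double_det_cnj: "double_det n u (cnj x) (\<lambda>k. cnj (\<zeta> k)) = cnj (double_det n u x \<zeta>)"
  by (simp add: double_det_def pdet_cnj)

lemma double_det_holomorphic: "(\<lambda>x. double_det n u x \<zeta>) holomorphic_on S"
  unfolding double_det_def by (intro holomorphic_intros pdet_holomorphic)

lemma double_det_continuous: "continuous_on UNIV (double_det n u x)"
  unfolding double_det_def[abs_def]
  by (intro continuous_intros continuous_on_compose2[OF pdet_continuous]
      continuous_on_coordinatewise_then_product) auto

section \<open>Interlacing and the choice of outcomes\<close>

text \<open>Follow the roots along the segment from f to g. They stay real, cannot pass R because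
  both ends are positive there, and cannot come in from beyond L. At the first parameter with a zero
  to the right of R, Hurwitz's theorem is violated, since all earlier combinations are zero-free on
  Re z > R.\<close>

lemma interlacing_pos:
  fixes f g :: "complex \<Rightarrow> complex"
  assumes hol: "f holomorphic_on UNIV" "g holomorphic_on UNIV"
    and nz: "\<And>t z. 0 \<le> t \<Longrightarrow> t \<le> 1 \<Longrightarrow> Im z \<noteq> 0 \<Longrightarrow> of_real (1 - t) * f z + of_real t * g z \<noteq> 0"
    and real: "\<And>x. Im (f (of_real x)) = 0" "\<And>x. Im (g (of_real x)) = 0"
    and fpos: "\<And>x. x \<ge> R \<Longrightarrow> Re (f (of_real x)) > 0"
    and gR: "Re (g (of_real R)) > 0"
    and glarge: "\<And>x. x \<ge> L \<Longrightarrow> Re (g (of_real x)) > 0"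
    and "x \<ge> R"
  shows "Re (g (of_real x)) > 0"
proof (rule ccontr)
  assume neg: "\<not> Re (g (of_real x)) > 0"
  then have "x < L" using glarge[of x] by (meson not_le)
  define h where "h t x = (1 - t) * Re (f (of_real x)) + t * Re (g (of_real x))" for t x
  have h_pos: "h t x > 0" if "0 \<le> t" "t \<le> 1" "Re (f (of_real x)) > 0" "Re (g (of_real x)) > 0" for t x
  proof (cases "t = 0")
    case False
    then show ?thesis unfolding h_def using that by (intro add_nonneg_pos) auto
  qed (use that in \<open>simp add: h_def\<close>)
  have cont: "continuous_on UNIV f" "continuous_on UNIV g"
    using hol by (auto intro: holomorphic_on_imp_continuous_on)
  \<comment> \<open>Compactness yields the first parameter \<open>t0\<close> at which positivity
    fails.\<close>
  define K where "K = ({0..1} \<times> {R..L}) \<inter> {q. h (fst q) (snd q) \<le> 0}"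
  have "closed {q. h (fst q) (snd q) \<le> 0}"
    unfolding h_def
    by (intro closed_Collect_le continuous_intros continuous_on_compose2[OF cont(1)]
        continuous_on_compose2[OF cont(2)]) auto
  then have "compact K" unfolding K_def by (intro compact_Int_closed compact_Times) auto
  moreover have "(1, x) \<in> K" using neg \<open>x \<ge> R\<close> \<open>x < L\<close> by (simp add: K_def h_def)
  ultimately obtain q0 where q0: "q0 \<in> K" "\<And>q. q \<in> K \<Longrightarrow> fst q0 \<le> fst q"
    using continuous_attains_inf[of K fst] continuous_on_fst[OF continuous_on_id] by blast
  obtain t0 x0 where tx: "q0 = (t0, x0)" by (cases q0)
  have t0: "0 \<le> t0" "t0 \<le> 1" and x0: "R \<le> x0" "x0 \<le> L" and h0: "h t0 x0 \<le> 0"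
    using q0(1) by (auto simp: K_def tx)
  have below: "h t x > 0" if "0 \<le> t" "t < t0" "x \<ge> R" for t x
  proof (cases "x \<le> L")
    case True
    then show ?thesis using q0(2)[of "(t, x)"] that t0 by (force simp: K_def tx)
  next
    case False
    then show ?thesis using that t0 by (intro h_pos fpos glarge) auto
  qed
  have "t0 \<noteq> 0" using h0 fpos[OF x0(1)] by (auto simp: h_def)
  then have "t0 > 0" using t0 by simp
  have "x0 \<noteq> R" using h0 h_pos[OF t0 fpos[of R] gR] by auto
  then have "x0 > R" using x0 by simp
  have "h t0 x0 = 0"
  proof (rule ccontr)
    assume "h t0 x0 \<noteq> 0"
    then have lt: "h t0 x0 < 0" using h0 by simp
    have f0: "h 0 x0 > 0" using fpos[OF x0(1)] by (simp add: h_def)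
    \<comment> \<open>\<open>h\<close> is affine in t, so a strictly negative value at
      \<open>t0\<close> would give a zero at the earlier parameter t0 c.\<close>
    define c where "c = h 0 x0 / (h 0 x0 - h t0 x0)"
    have c: "0 < c" "c < 1" using lt f0 by (auto simp: c_def field_simps)
    have "h (t0 * c) x0 = h 0 x0 + c * (h t0 x0 - h 0 x0)" by (simp add: h_def algebra_simps)
    also have "\<dots> = 0" using lt f0 by (simp add: c_def field_simps)
    finally show False using below[of "t0 * c" x0] c \<open>t0 > 0\<close> x0 by simp
  qed
  define G where "G t z = of_real (1 - t) * f z + of_real t * g z" for t z
  have G_real: "G t (of_real x) = of_real (h t x)" for t x
    by (simp add: G_def h_def complex_eq_iff real)
  define T where "T n = t0 * (real n / real (Suc n))" for n
  have T: "0 \<le> T n" "T n < t0" for n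
    using \<open>t0 > 0\<close> by (auto simp: T_def field_simps)
  have "(\<lambda>n. real n / real (Suc n)) \<longlonglongrightarrow> 1"
    by (rule LIMSEQ_n_over_Suc_n)
  then have T_lim: "T \<longlonglongrightarrow> t0" unfolding T_def using tendsto_mult_left[of _ 1 _ t0] by fastforce
  have hol_G: "G t holomorphic_on S" for t S
    unfolding G_def by (intro holomorphic_intros holomorphic_on_subset[OF hol(1)] holomorphic_on_subset[OF hol(2)]) auto
  have "G t0 (of_real x0) \<noteq> 0"
  proof (rule Hurwitz_no_zeros[of "{z. Re z > R}" "\<lambda>n. G (T n)" "G t0"])
    show "open {z. Re z > R}" by (rule open_halfspace_Re_gt)
    show "connected {z. Re z > R}" by (intro convex_connected convex_halfspace_Re_gt)
    show "uniform_limit S (\<lambda>n. G (T n)) (G t0) sequentially" if "compact S" "S \<subseteq> {z. Re z > R}" for S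
    proof -
      have "compact ((\<lambda>z. g z - f z) ` S)"
        using that(1) cont by (intro compact_continuous_image continuous_intros) (auto intro: continuous_on_subset)
      then obtain B where "B > 0" and B: "\<And>z. z \<in> S \<Longrightarrow> norm (g z - f z) \<le> B"
        using compact_imp_bounded bounded_pos by (metis (mono_tags, lifting) imageI)
      show ?thesis
      proof (rule uniform_limitI)
        fix e :: real assume "e > 0"
        then have "\<forall>\<^sub>F n in sequentially. dist (T n) t0 < e / B"
          using T_lim \<open>B > 0\<close> by (intro tendstoD) auto
        then show "\<forall>\<^sub>F n in sequentially. \<forall>z\<in>S. dist (G (T n) z) (G t0 z) < e"
        proof eventually_elim
          case (elim n)
          show ?case
          proof
            fix z assume "z \<in> S"
            have "G (T n) z - G t0 z = of_real (T n - t0) * (g z - f z)"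
              by (simp add: G_def algebra_simps)
            then have "dist (G (T n) z) (G t0 z) = \<bar>T n - t0\<bar> * norm (g z - f z)"
              by (simp add: dist_norm norm_mult flip: of_real_diff)
            also have "\<dots> \<le> \<bar>T n - t0\<bar> * B" using B[OF \<open>z \<in> S\<close>] by (intro mult_left_mono) auto
            also have "\<dots> < e" using elim \<open>B > 0\<close> by (simp add: dist_real_def field_simps)
            finally show "dist (G (T n) z) (G t0 z) < e" .
          qed
        qed
      qed
    qed
    show "\<not> G t0 constant_on {z. Re z > R}"
    proof
      assume "G t0 constant_on {z. Re z > R}"
      then have "G t0 (of_real x0) = G t0 (of_real L)"
        using \<open>x0 > R\<close> x0 unfolding constant_on_def by force
      then have "h t0 L = 0" using \<open>h t0 x0 = 0\<close> by (simp add: G_real)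
      moreover have "h t0 L > 0" using x0 t0 by (intro h_pos fpos glarge) auto
      ultimately show False by simp
    qed
    show "G (T n) z \<noteq> 0" if "z \<in> {z. Re z > R}" for n z
    proof (cases "Im z = 0")
      case True
      then have "z = of_real (Re z)" by (simp add: complex_eq_iff)
      moreover have "h (T n) (Re z) > 0" using that T by (intro below) auto
      ultimately show ?thesis using G_real[of "T n" "Re z"] by simp
    next
      case False
      then show ?thesis unfolding G_def using T[of n] t0 by (intro nz) auto
    qed
  qed (use hol_G \<open>x0 > R\<close> in auto)
  then show False using \<open>h t0 x0 = 0\<close> by (simp add: G_real)
qed

text \<open>Evaluated where the coordinates of indices 1 to k are 0, this averages \<open>p\<close>
  over independent centred variables of variances \<open>V i\<close> in those indices, with opposite
  signs in the two copies; later coordinates hold outcomes already fixed.\<close>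

primrec mixed :: "(nat \<Rightarrow> real) \<Rightarrow> nat \<Rightarrow> ((nat \<times> bool \<Rightarrow> complex) \<Rightarrow> complex) \<Rightarrow> (nat \<times> bool \<Rightarrow> complex) \<Rightarrow> complex" where
  "mixed V 0 p = p"
| "mixed V (Suc k) p = lieb_sokal (of_real (V (Suc k))) (Suc k, False) (Suc k, True) (mixed V k p)"

lemma mixed_cong: "(\<And>i. i \<in> {1..k} \<Longrightarrow> V i = W i) \<Longrightarrow> mixed V k p = mixed W k p"
  by (induction k) auto

lemma multiaffine_mixed: "multiaffine p \<Longrightarrow> multiaffine (mixed V k p)"
  by (induction k) (auto intro: multiaffine_lieb_sokal)

lemma continuous_on_mixed: "continuous_on UNIV p \<Longrightarrow> continuous_on UNIV (mixed V k p)"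
  by (induction k) (auto intro: continuous_on_lieb_sokal)

lemma conj_rel_mixed: "conj_rel p q \<Longrightarrow> conj_rel (mixed V k p) (mixed V k q)"
  by (induction k) (auto intro: conj_rel_lieb_sokal)

lemma stable_above_mixed:
  assumes "multiaffine p" "stable_above \<eta> p" "\<And>i. i \<in> {1..k} \<Longrightarrow> V i \<ge> 0"
  shows "stable_above \<eta> (mixed V k p)"
  using assms(3)
proof (induction k)
  case (Suc k)
  then have "stable_above \<eta> (mixed V k p)" "V (Suc k) \<ge> 0" by auto
  then show ?case
    unfolding mixed.simps by (intro stable_above_lieb_sokal multiaffine_mixed assms(1)) auto
qed (simp add: assms(2))

lemma mixed_holomorphic:
  assumes "\<And>\<zeta>. (\<lambda>x. p x \<zeta>) holomorphic_on S"
  shows "(\<lambda>x. mixed V k (p x) \<zeta>) holomorphic_on S"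
proof (induction k arbitrary: \<zeta>)
  case (Suc k)
  then show ?case by (simp add: lieb_sokal_def slope_def) (intro holomorphic_intros Suc)
qed (simp add: assms)

lemma conj_rel_double_det: "conj_rel (double_det n u (cnj x)) (double_det n u x)"
  by (simp add: conj_rel_def double_det_cnj)

lemma conj_rel_double_det_real:
  "conj_rel (double_det n u (of_real x)) (double_det n u (of_real x))"
  using conj_rel_double_det[of n u "of_real x"] by simp

text \<open>Real-rootedness in x. For Im x > 0 a small \<eta> makes the product zero-free above -
  \<eta>, the operators preserve this, and real points lie in that region; conjugation settles Im x
  < 0.\<close>

lemma mixed_double_det_nonzero:
  fixes u :: "nat \<Rightarrow> complex ^ 'm" and \<rho> :: "nat \<times> bool \<Rightarrow> real"
  assumes "Im x \<noteq> 0" "\<And>i. i \<in> {1..k} \<Longrightarrow> V i \<ge> 0"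
  shows "mixed V k (double_det n u x) (\<lambda>j. of_real (\<rho> j)) \<noteq> 0"
proof -
  have upper: "mixed V k (double_det n u x) (\<lambda>j. of_real (\<rho> j)) \<noteq> 0" if "Im x > 0" for x
  proof -
    define N where "N = (\<Sum>k=1..n. (norm (u k))\<^sup>2)"
    define \<eta> where "\<eta> = Im x / (N + 1)"
    have "N \<ge> 0" by (simp add: N_def sum_nonneg)
    then have \<eta>: "\<eta> > 0" "\<eta> * N < Im x" using that by (auto simp: \<eta>_def field_simps)
    have "stable_above (- \<eta>) (double_det n u x)"
      unfolding stable_above_def double_det_def mult_eq_0_iff de_Morgan_disj
      using \<eta> by (intro allI impI conjI pdet_nonzero_complex[of \<eta>]) (auto simp: N_def less_imp_le)
    then have "stable_above (- \<eta>) (mixed V k (double_det n u x))"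
      using assms(2) by (intro stable_above_mixed multiaffine_double_det)
    then show ?thesis using \<eta> by (simp add: stable_above_def)
  qed
  show ?thesis
  proof (cases "Im x > 0")
    case True
    then show ?thesis by (rule upper)
  next
    case False
    then have "Im (cnj x) > 0" using assms(1) by simp
    from upper[OF this] show ?thesis
      using conj_rel_mixed[OF conj_rel_double_det[of n u x], of V k,
          unfolded conj_rel_def, rule_format, of "\<lambda>j. of_real (\<rho> j)"] by auto
  qed
qed

text \<open>\<open>form\<close> is the variance hypothesis as a quadratic form: the square of
  \<open>outer_self u\<close> is \<open>outer_self u\<close> times the squared norm of u.\<close>

context
  fixes n :: nat and u :: "nat \<Rightarrow> complex ^ 'm" and V :: "nat \<Rightarrow> real" and \<sigma> :: real
  assumes \<sigma>: "\<sigma> > 0"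
    and V: "\<And>i. i \<in> {1..n} \<Longrightarrow> V i \<ge> 0"
    and form: "\<And>v. (\<Sum>i=1..n. V i * (norm (u i))\<^sup>2 * (cmod (cinner (u i) v))\<^sup>2) \<le> \<sigma>\<^sup>2 * (norm v)\<^sup>2"
begin

text \<open>Test \<open>form\<close> on \<open>u i\<close> and keep only the i-th summand.\<close>

lemma variance_norm_bound:
  assumes "i \<in> {1..n}" shows "V i * (norm (u i)) ^ 4 \<le> \<sigma>\<^sup>2"
proof (cases "u i = 0")
  case False
  have "V i * (norm (u i))\<^sup>2 * (cmod (cinner (u i) (u i)))\<^sup>2 \<le>
      (\<Sum>j=1..n. V j * (norm (u j))\<^sup>2 * (cmod (cinner (u j) (u i)))\<^sup>2)"
    using assms V by (intro member_le_sum) auto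
  also have "\<dots> \<le> \<sigma>\<^sup>2 * (norm (u i))\<^sup>2" by (rule form)
  finally have "(V i * (norm (u i)) ^ 4) * (norm (u i))\<^sup>2 \<le> \<sigma>\<^sup>2 * (norm (u i))\<^sup>2"
    by (simp add: cinner_self power2_eq_square power4_eq_xxxx algebra_simps norm_mult)
  then show ?thesis using False by simp
qed simp

text \<open>The shift by 2 / \<sigma> V i (norm (u i))^2 costs only 2 \<sigma> in the quadratic
  form, by \<open>form\<close>; the shift by \<open>a i\<close> is paid for crudely, by
  Cauchy-Schwarz.\<close>

lemma pdet_pos_shift:
  assumes y: "\<And>i. i \<in> {1..n} \<Longrightarrow> y i \<ge> - a i - 2 / \<sigma> * V i * (norm (u i))\<^sup>2"
    and a: "\<And>i. i \<in> {1..n} \<Longrightarrow> a i \<ge> 0"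
    and x: "(\<Sum>i=1..n. a i * (norm (u i))\<^sup>2) + 2 * \<sigma> < x"
  shows "Re (pdet n u (of_real x) (\<lambda>k. of_real (y k))) > 0"
proof (rule pdet_pos)
  let ?s = "\<Sum>i=1..n. a i * (norm (u i))\<^sup>2"
  show "x - ?s - 2 * \<sigma> > 0" using x by simp
  have "?s \<ge> 0" using a by (intro sum_nonneg) auto
  then show "x > 0" using x \<sigma> by linarith
  fix v
  have "y i * (cmod (cinner (u i) v))\<^sup>2 \<ge> - (a i * (norm (u i))\<^sup>2 * (norm v)\<^sup>2)
      - 2 / \<sigma> * (V i * (norm (u i))\<^sup>2 * (cmod (cinner (u i) v))\<^sup>2)" if "i \<in> {1..n}" for i
  proof -
    have "(cmod (cinner (u i) v))\<^sup>2 \<le> (norm (u i) * norm v)\<^sup>2"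
      by (intro power_mono cinner_Cauchy_Schwarz) simp
    then have "a i * (cmod (cinner (u i) v))\<^sup>2 \<le> a i * ((norm (u i))\<^sup>2 * (norm v)\<^sup>2)"
      using a[OF that] by (intro mult_left_mono) (auto simp: power_mult_distrib)
    moreover have "(- a i - 2 / \<sigma> * V i * (norm (u i))\<^sup>2) * (cmod (cinner (u i) v))\<^sup>2 \<le> y i * (cmod (cinner (u i) v))\<^sup>2"
      using y[OF that] by (intro mult_right_mono) auto
    ultimately show ?thesis by (simp add: algebra_simps)
  qed
  then have "(\<Sum>i=1..n. - (a i * (norm (u i))\<^sup>2 * (norm v)\<^sup>2)
      - 2 / \<sigma> * (V i * (norm (u i))\<^sup>2 * (cmod (cinner (u i) v))\<^sup>2)) \<le> (\<Sum>i=1..n. y i * (cmod (cinner (u i) v))\<^sup>2)"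
    by (intro sum_mono)
  moreover have "(\<Sum>i=1..n. - (a i * (norm (u i))\<^sup>2 * (norm v)\<^sup>2)
      - 2 / \<sigma> * (V i * (norm (u i))\<^sup>2 * (cmod (cinner (u i) v))\<^sup>2)) =
      - (?s * (norm v)\<^sup>2) - 2 / \<sigma> * (\<Sum>i=1..n. V i * (norm (u i))\<^sup>2 * (cmod (cinner (u i) v))\<^sup>2)"
    by (simp only: sum_subtractf sum_negf sum_distrib_left[symmetric] sum_distrib_right[symmetric])
  moreover have "2 / \<sigma> * (\<Sum>i=1..n. V i * (norm (u i))\<^sup>2 * (cmod (cinner (u i) v))\<^sup>2) \<le> 2 / \<sigma> * (\<sigma>\<^sup>2 * (norm v)\<^sup>2)"
    using \<sigma> form by (intro mult_left_mono) auto
  moreover have "2 / \<sigma> * (\<sigma>\<^sup>2 * (norm v)\<^sup>2) = 2 * \<sigma> * (norm v)\<^sup>2"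
    using \<sigma> by (simp add: power2_eq_square)
  ultimately show "(x - ?s - 2 * \<sigma>) * (norm v)\<^sup>2 \<le> x * (norm v)\<^sup>2 + (\<Sum>k=1..n. y k * (cmod (cinner (u k) v))\<^sup>2)"
    unfolding left_diff_distrib by linarith
qed

text \<open>The sum in the bound on x absorbs an arbitrary \<rho>. With \<rho> = 0 this is the bound
  for the expected polynomial; with general \<rho> it supplies positivity for large x in the
  interlacing argument.\<close>

lemma mixed_pos:
  assumes x: "x \<ge> 4 * \<sigma> + (\<Sum>i=1..n. (\<bar>\<rho> (i, False)\<bar> + \<bar>\<rho> (i, True)\<bar>) * (norm (u i))\<^sup>2)"
    and "k \<le> n"
  shows "re_fun (mixed V k (double_det n u (of_real x))) \<rho> > 0"
proof -
  define A where "A = (\<lambda>i. \<bar>\<rho> (i, False)\<bar> + \<bar>\<rho> (i, True)\<bar>)"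
  \<comment> \<open>Lowering by \<open>\<delta>\<close> costs 2 \<sigma>, and the remaining gap of 2
    \<sigma> bounds the initial logarithmic derivatives by \<open>\<phi>\<close>.\<close>
  define \<delta> where "\<delta> = (\<lambda>i. 2 / \<sigma> * V i * (norm (u i))\<^sup>2)"
  define \<phi> where "\<phi> = (\<lambda>i. (norm (u i))\<^sup>2 / (2 * \<sigma>))"
  \<comment> \<open>After k operators the coordinates of indices 1 to k are back at \<rho>, the
    later ones are still lowered.\<close>
  define r where "r k = (\<lambda>j. if fst j \<in> {k<..n} then \<rho> j - \<delta> (fst j) else \<rho> j)" for k
  define f where "f k = re_fun (mixed V k (double_det n u (of_real x)))" for k
  have "(\<Sum>i=1..n. A i * (norm (u i))\<^sup>2) \<ge> 0" by (intro sum_nonneg) (auto simp: A_def)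
  then have "x > 0" and x4: "(\<Sum>i=1..n. A i * (norm (u i))\<^sup>2) + 4 * \<sigma> \<le> x"
    using x \<sigma> by (auto simp: A_def)
  have \<delta>: "\<delta> i \<ge> 0" if "i \<in> {1..n}" for i using V[OF that] \<sigma> by (simp add: \<delta>_def)
  have rho: "\<rho> j \<ge> - A (fst j)" for j by (cases j; cases "snd j") (auto simp: A_def)
  have re_mult: "re_fun (double_det n u (of_real x)) \<theta> =
      Re (pdet n u (of_real x) (\<lambda>i. of_real (\<theta> (i, False)))) * Re (pdet n u (of_real x) (\<lambda>i. of_real (\<theta> (i, True))))" for \<theta>
    using pdet_cnj[of n u "of_real x" "\<lambda>i. of_real (\<theta> (i, True))"]
    by (simp add: re_fun_def double_det_def complex_eq_iff)
  have init: "f 0 \<theta> > 0"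
    if \<theta>: "\<And>j. fst j \<in> {1..n} \<Longrightarrow> \<theta> j \<ge> - (A (fst j) + e (fst j)) - \<delta> (fst j)"
      and e: "\<And>i. i \<in> {1..n} \<Longrightarrow> e i \<ge> 0" "(\<Sum>i=1..n. e i * (norm (u i))\<^sup>2) < 2 * \<sigma>" for \<theta> e
  proof -
    have "Re (pdet n u (of_real x) (\<lambda>i. of_real (\<theta> (i, s)))) > 0" for s
    proof (rule pdet_pos_shift)
      show "\<theta> (i, s) \<ge> - (A i + e i) - 2 / \<sigma> * V i * (norm (u i))\<^sup>2" if "i \<in> {1..n}" for i
        using \<theta>[of "(i, s)"] that by (simp add: \<delta>_def)
      show "A i + e i \<ge> 0" if "i \<in> {1..n}" for i using e(1)[OF that] by (simp add: A_def)
      show "(\<Sum>i=1..n. (A i + e i) * (norm (u i))\<^sup>2) + 2 * \<sigma> < x"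
        using x4 e(2) by (simp add: distrib_right sum.distrib)
    qed
    then show ?thesis by (simp add: f_def re_mult)
  qed
  have stab: "stable_above 0 (double_det n u (of_real x))"
    unfolding stable_above_def double_det_def mult_eq_0_iff de_Morgan_disj
    using \<open>x > 0\<close> by (intro allI impI conjI pdet_nonzero_upper) auto
  have "(\<forall>\<theta>\<in>upper_cone (r k). f k \<theta> > 0) \<and>
      (\<forall>i\<in>{k<..n}. \<forall>s. slope (i, s) (f k) (r k) \<le> \<phi> i * f k (r k))"
    using \<open>k \<le> n\<close>
  proof (induction k)
    case 0
    have pos: "f 0 \<theta> > 0" if "\<theta> \<in> upper_cone (r 0)" for \<theta>
    proof (rule init[where e = "\<lambda>_. 0"])
      fix j :: "nat \<times> bool" assume "fst j \<in> {1..n}"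
      moreover have "r 0 j \<le> \<theta> j" using that by (cases j) (simp add: upper_cone_def)
      ultimately have "\<theta> j \<ge> \<rho> j - \<delta> (fst j)" by (simp add: r_def)
      then show "\<theta> j \<ge> - (A (fst j) + 0) - \<delta> (fst j)" using rho[of j] by simp
    qed (use \<sigma> in auto)
    have "slope (i, s) (f 0) (r 0) \<le> \<phi> i * f 0 (r 0)" if i: "i \<in> {1..n}" for i s
    proof (rule ccontr)
      let ?F = "f 0 (r 0)" and ?G = "slope (i, s) (f 0) (r 0)"
      assume "\<not> ?G \<le> \<phi> i * ?F"
      then have G: "?G > \<phi> i * ?F" by simp
      have F: "?F > 0" by (intro pos upper_cone_refl)
      have "\<phi> i \<ge> 0" using \<sigma> by (simp add: \<phi>_def)
      then have "?G > 0" using F G by (smt (verit) mult_nonneg_nonneg)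
      \<comment> \<open>By affinity, lowering the coordinate by \<open>t\<close> reaches a zero; a
        logarithmic derivative above \<open>\<phi>\<close> would put this zero inside the gap, where
        \<open>init\<close> gives positivity.\<close>
      define t where "t = ?F / ?G"
      have t: "t > 0" "t * (norm (u i))\<^sup>2 < 2 * \<sigma>"
        using F G \<open>?G > 0\<close> \<sigma> by (auto simp: t_def \<phi>_def field_simps)
      have "f 0 ((r 0)((i, s) := r 0 (i, s) - t)) > 0"
      proof (rule init[where e = "\<lambda>j. if j = i then t else 0"])
        fix j :: "nat \<times> bool" assume "fst j \<in> {1..n}"
        then show "((r 0)((i, s) := r 0 (i, s) - t)) j \<ge> - (A (fst j) + (if fst j = i then t else 0)) - \<delta> (fst j)"
          using rho[of j] t by (auto simp: r_def)
      next
        show "(\<Sum>j=1..n. (if j = i then t else 0) * (norm (u j))\<^sup>2) < 2 * \<sigma>"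
          using i t by (simp add: if_distrib[of "\<lambda>a. a * _"] cong: if_cong)
      qed (use t in auto)
      moreover have "multiaffine (f 0)"
        unfolding f_def by (intro multiaffine_re_fun multiaffine_mixed multiaffine_double_det)
      ultimately have "?F - t * ?G > 0" by (simp add: multiaffineD)
      then show False using \<open>?G > 0\<close> by (simp add: t_def)
    qed
    then show ?case using pos by auto
  next
    case (Suc k)
    let ?p = "mixed V k (double_det n u (of_real x))" and ?i = "Suc k"
    have i: "?i \<in> {1..n}" using Suc by simp
    have p: "multiaffine ?p" "stable_above 0 ?p" "continuous_on UNIV ?p" "conj_rel ?p ?p"
      using Suc V by (auto intro!: multiaffine_mixed multiaffine_double_det stable_above_mixed stab
          continuous_on_mixed double_det_continuous conj_rel_mixed conj_rel_double_det_real)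
    have fk: "multiaffine (f k)" "rayleigh (f k)" "diag_bezout (f k)"
      unfolding f_def
      using multiaffine_re_fun[OF p(1)] stable_rayleigh[OF p] stable_diag_bezout[OF p] by auto
    have IH: "\<And>\<theta>. \<theta> \<in> upper_cone (r k) \<Longrightarrow> f k \<theta> > 0"
      "\<And>i s. i \<in> {k<..n} \<Longrightarrow> slope (i, s) (f k) (r k) \<le> \<phi> i * f k (r k)"
      using Suc by auto
    have fSuc: "f (Suc k) = lieb_sokal (V ?i) (?i, False) (?i, True) (f k)"
      by (simp add: f_def re_fun_lieb_sokal)
    have rSuc: "r (Suc k) = (r k)((?i, False) := r k (?i, False) + \<delta> ?i, (?i, True) := r k (?i, True) + \<delta> ?i)"
      using Suc.prems by (force simp: r_def fun_eq_iff)
    have small: "V ?i * (2 * \<phi> ?i) \<le> \<delta> ?i"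
      using V[OF i] \<sigma> by (simp add: \<phi>_def \<delta>_def field_simps)
    have "V ?i * (\<phi> ?i)\<^sup>2 = (V ?i * norm (u ?i) ^ 4) / (4 * \<sigma>\<^sup>2)"
      by (simp add: \<phi>_def power2_eq_square power4_eq_xxxx)
    also have "\<dots> \<le> \<sigma>\<^sup>2 / (4 * \<sigma>\<^sup>2)" using variance_norm_bound[OF i] by (intro divide_right_mono) auto
    also have "\<dots> < 1" using \<sigma> by simp
    finally have small2: "V ?i * (\<phi> ?i)\<^sup>2 < 1" .
    have "\<phi> ?i \<ge> 0" using \<sigma> by (simp add: \<phi>_def)
    note step = barrier_step[OF fk IH(1) _ IH(2) IH(2) V[OF i] \<delta>[OF i] this small small2 rSuc]
    show ?case
    proof (intro conjI ballI allI)
      fix \<theta> assume "\<theta> \<in> upper_cone (r (Suc k))"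
      then show "f (Suc k) \<theta> > 0" unfolding fSuc using Suc.prems by (intro step(1)) auto
    next
      fix i s assume "i \<in> {Suc k<..n}"
      then show "slope (i, s) (f (Suc k)) (r (Suc k)) \<le> \<phi> i * f (Suc k) (r (Suc k))"
        unfolding fSuc using Suc.prems by (intro step(2) IH(2)) auto
    qed
  qed
  moreover have "\<rho> \<in> upper_cone (r k)"
  proof -
    have "{j. \<rho> j \<noteq> r k j} \<subseteq> {..n} \<times> UNIV" by (auto simp: r_def split: if_splits)
    then have "finite {j. \<rho> j \<noteq> r k j}" by (rule finite_subset) simp
    moreover have "r k j \<le> \<rho> j" for j
      using \<delta>[of "fst j"] by (auto simp: r_def)
    ultimately show ?thesis by (simp add: upper_cone_def)
  qed
  ultimately show ?thesis by (simp add: f_def)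
qed

text \<open>\<open>law\<close> is what remains of a law on \<Omega> with mean m and variance
  \<open>V (Suc k)\<close>: a quadratic that is nonpositive on \<Omega> has nonpositive expectation.
  It is used only at x = R, where a positive average yields a positive outcome; interlacing extends
  positivity to all x \<ge> R.\<close>

lemma mixed_choose:
  assumes "Suc k \<le> n"
    and law: "\<And>a b c. (\<forall>\<omega>\<in>\<Omega>. a + b * (\<omega> - m) + c * (\<omega> - m)\<^sup>2 \<le> 0) \<Longrightarrow> a + c * V (Suc k) \<le> 0"
    and \<rho>0: "\<rho> (Suc k, False) = 0" "\<rho> (Suc k, True) = 0"
    and pos: "\<And>x. x \<ge> R \<Longrightarrow> re_fun (mixed V (Suc k) (double_det n u (of_real x))) \<rho> > 0"
  shows "\<exists>\<omega>\<in>\<Omega>. \<forall>x\<ge>R. re_fun (mixed V k (double_det n u (of_real x)))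
    (\<rho>((Suc k, False) := - (\<omega> - m), (Suc k, True) := \<omega> - m)) > 0"
proof -
  let ?a = "(Suc k, False)" and ?b = "(Suc k, True)"
  define P where "P z = mixed V k (double_det n u z)" for z
  define \<zeta> where "\<zeta> = (\<lambda>j. complex_of_real (\<rho> j))"
  have V_Suc: "V (Suc k) \<ge> 0" using V assms(1) by simp
  have P: "multiaffine (P z)" for z
    unfolding P_def by (intro multiaffine_mixed multiaffine_double_det)
  define q where "q = re_fun (P (of_real R))"
  have "\<exists>\<omega>\<in>\<Omega>. q (\<rho>(?a := - (\<omega> - m), ?b := \<omega> - m)) > 0"
  proof (rule ccontr)
    assume neg: "\<not> ?thesis"
    have "multiaffine q" unfolding q_def by (intro multiaffine_re_fun P)
    then have q_expand: "q (\<rho>(?a := - h, ?b := h)) =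
        q \<rho> + (slope ?b q \<rho> - slope ?a q \<rho>) * h + (- slope ?a (slope ?b q) \<rho>) * h\<^sup>2" for h
      using multiaffine_upd2[of q ?a ?b \<rho> "-h" h] \<rho>0 by (simp add: algebra_simps power2_eq_square)
    have "\<forall>\<omega>\<in>\<Omega>. q (\<rho>(?a := - (\<omega> - m), ?b := \<omega> - m)) \<le> 0" using neg not_less by blast
    then have "q \<rho> + (- slope ?a (slope ?b q) \<rho>) * V (Suc k) \<le> 0"
      unfolding q_expand by (rule law)
    moreover have "re_fun (mixed V (Suc k) (double_det n u (of_real R))) \<rho> =
        q \<rho> - V (Suc k) * slope ?a (slope ?b q) \<rho>"
      by (simp add: re_fun_lieb_sokal q_def P_def) (simp add: lieb_sokal_def)
    ultimately show False using pos[of R] by (simp add: mult.commute)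
  qed
  then obtain \<omega> where "\<omega> \<in> \<Omega>" and \<omega>: "q (\<rho>(?a := - (\<omega> - m), ?b := \<omega> - m)) > 0" by blast
  define h where "h = \<omega> - m"
  define \<rho>' where "\<rho>' = \<rho>(?a := - h, ?b := h)"
  define F where "F z = mixed V (Suc k) (double_det n u z) \<zeta>" for z
  define G where "G z = P z (\<lambda>j. of_real (\<rho>' j))" for z
  have expand: "P z (\<lambda>j. of_real ((\<rho>(?a := - r, ?b := r)) j)) =
      P z \<zeta> - r * slope ?a (P z) \<zeta> + r * slope ?b (P z) \<zeta> - r\<^sup>2 * slope ?a (slope ?b (P z)) \<zeta>" for r z
  proof -
    have "(\<lambda>j. complex_of_real ((\<rho>(?a := - r, ?b := r)) j)) =
        \<zeta>(?a := \<zeta> ?a + - of_real r, ?b := \<zeta> ?b + of_real r)"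
      by (auto simp: \<zeta>_def \<rho>0 fun_eq_iff)
    then show ?thesis
      using multiaffine_upd2[OF P[of z], of ?a ?b \<zeta> "- of_real r" "of_real r"]
      by (simp add: power2_eq_square)
  qed
  have real: "Im (mixed V j (double_det n u (of_real x)) (\<lambda>j. of_real (\<theta> j))) = 0" for j x \<theta>
    by (subst conj_rel_re_fun[OF conj_rel_mixed[OF conj_rel_double_det_real]]) simp
  have ReG: "Re (G (of_real x)) = re_fun (mixed V k (double_det n u (of_real x))) \<rho>'" for x
    by (simp add: G_def P_def re_fun_def)
  have "Re (G (of_real x)) > 0" if "x \<ge> R" for x
  proof (rule interlacing_pos[of F G])
    show "F holomorphic_on UNIV" "G holomorphic_on UNIV"
      unfolding F_def G_def P_def by (intro mixed_holomorphic double_det_holomorphic)+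
    show "Im (F (of_real x)) = 0" "Im (G (of_real x)) = 0" for x
      unfolding F_def G_def P_def \<zeta>_def by (rule real)+
    show "Re (F (of_real x)) > 0" if "x \<ge> R" for x
      using pos[OF that] by (simp add: F_def \<zeta>_def re_fun_def)
    show "Re (G (of_real R)) > 0"
      using \<omega> by (simp add: ReG \<rho>'_def h_def q_def P_def)
    show "Re (G (of_real x)) > 0"
      if "x \<ge> 4 * \<sigma> + (\<Sum>i=1..n. (\<bar>\<rho>' (i, False)\<bar> + \<bar>\<rho>' (i, True)\<bar>) * (norm (u i))\<^sup>2)" for x
      unfolding ReG using that assms(1) by (intro mixed_pos) auto
    show "x \<ge> R" by fact
    fix t :: real and z :: complex
    assume t: "0 \<le> t" "t \<le> 1" and "Im z \<noteq> 0"
    (* F and G belong to the laws with (mean, variance) = (0, V (Suc k)) and (h, 0);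
       their mixture has mean t h and variance w *)
    define w where "w = (1 - t) * (V (Suc k) + t * h\<^sup>2)"
    have "w \<ge> 0" using t V_Suc by (simp add: w_def)
    define \<theta> where "\<theta> = \<rho>(?a := - (t * h), ?b := t * h)"
    have slope_const: "slope ?a (slope ?b (P z)) (\<lambda>j. of_real (\<theta> j)) = slope ?a (slope ?b (P z)) \<zeta>"
    proof -
      have "(\<lambda>j. complex_of_real (\<theta> j)) = (\<zeta>(?b := of_real (t * h)))(?a := - of_real (t * h))"
        by (auto simp: \<theta>_def \<zeta>_def fun_eq_iff)
      then show ?thesis by (metis slope_commute slope_upd_same)
    qed
    have "mixed (V(Suc k := w)) k p = mixed V k p" for p
      by (intro mixed_cong) auto
    then have "mixed (V(Suc k := w)) (Suc k) (double_det n u z) (\<lambda>j. of_real (\<theta> j)) =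
        P z (\<lambda>j. of_real (\<theta> j)) - w * slope ?a (slope ?b (P z)) \<zeta>"
      using slope_const by (simp add: lieb_sokal_def P_def)
    also have "\<dots> = of_real (1 - t) * F z + of_real t * G z"
      unfolding G_def \<rho>'_def \<theta>_def expand
      by (simp add: F_def lieb_sokal_def P_def w_def algebra_simps power2_eq_square)
    finally show "of_real (1 - t) * F z + of_real t * G z \<noteq> 0"
      using mixed_double_det_nonzero[OF \<open>Im z \<noteq> 0\<close>, of "Suc k" "V(Suc k := w)" n u \<theta>]
        V assms(1) \<open>w \<ge> 0\<close> by simp
  qed
  then show ?thesis
    using \<open>\<omega> \<in> \<Omega>\<close> by (intro bexI[of _ \<omega>]) (auto simp: ReG \<rho>'_def h_def)
qed

text \<open>Outcomes are fixed from index n downwards, since the outermost operator of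
  \<open>mixed\<close> has the largest index. The start, with nothing fixed, is
  \<open>mixed_pos\<close> at the origin.\<close>

lemma exists_outcomes:
  assumes law: "\<And>i a b c. i \<in> {1..n} \<Longrightarrow>
      (\<forall>\<omega>\<in>\<Omega> i. a + b * (\<omega> - m i) + c * (\<omega> - m i)\<^sup>2 \<le> 0) \<Longrightarrow> a + c * V i \<le> 0"
  shows "\<exists>\<epsilon>. (\<forall>i\<in>{1..n}. \<epsilon> i \<in> \<Omega> i) \<and> (\<forall>x\<ge>4 * \<sigma>. re_fun (double_det n u (of_real x))
    (\<lambda>(i, s). if i \<in> {1..n} then if s then \<epsilon> i - m i else - (\<epsilon> i - m i) else 0) > 0)"
proof -
  define \<theta> where "\<theta> k \<epsilon> = (\<lambda>(i, s). if i \<in> {Suc k..n} then if s then \<epsilon> i - m i else - (\<epsilon> i - m i) else 0)"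
    for k and \<epsilon> :: "nat \<Rightarrow> real"
  have "\<exists>\<epsilon>. (\<forall>i\<in>{Suc k..n}. \<epsilon> i \<in> \<Omega> i) \<and>
      (\<forall>x\<ge>4 * \<sigma>. re_fun (mixed V k (double_det n u (of_real x))) (\<theta> k \<epsilon>) > 0)" if "k \<le> n" for k
    using that
  proof (induction rule: inc_induct)
    case base
    have "\<theta> n \<epsilon> = (\<lambda>_. 0)" for \<epsilon> by (auto simp: \<theta>_def)
    then show ?case using mixed_pos[of "\<lambda>_. 0" _ n] by auto
  next
    case (step k)
    then obtain \<epsilon> where \<epsilon>: "\<forall>i\<in>{Suc (Suc k)..n}. \<epsilon> i \<in> \<Omega> i"
      "\<And>x. x \<ge> 4 * \<sigma> \<Longrightarrow> re_fun (mixed V (Suc k) (double_det n u (of_real x))) (\<theta> (Suc k) \<epsilon>) > 0" by blast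
    have "Suc k \<le> n" using step by simp
    then have "\<exists>\<omega>\<in>\<Omega> (Suc k). \<forall>x\<ge>4 * \<sigma>. re_fun (mixed V k (double_det n u (of_real x)))
      ((\<theta> (Suc k) \<epsilon>)((Suc k, False) := - (\<omega> - m (Suc k)), (Suc k, True) := \<omega> - m (Suc k))) > 0"
      using law[of "Suc k"] \<epsilon>(2) by (intro mixed_choose) (auto simp: \<theta>_def)
    then obtain \<omega> where \<omega>: "\<omega> \<in> \<Omega> (Suc k)" "\<forall>x\<ge>4 * \<sigma>. re_fun (mixed V k (double_det n u (of_real x)))
      ((\<theta> (Suc k) \<epsilon>)((Suc k, False) := - (\<omega> - m (Suc k)), (Suc k, True) := \<omega> - m (Suc k))) > 0" by blast
    moreover have "(\<theta> (Suc k) \<epsilon>)((Suc k, False) := - (\<omega> - m (Suc k)), (Suc k, True) := \<omega> - m (Suc k)) =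
        \<theta> k (\<epsilon>(Suc k := \<omega>))"
      using \<open>Suc k \<le> n\<close> by (auto simp: \<theta>_def fun_eq_iff)
    moreover have "\<forall>i\<in>{Suc k..n}. (\<epsilon>(Suc k := \<omega>)) i \<in> \<Omega> i"
      using \<epsilon>(1) \<omega>(1) by (auto simp: Suc_le_eq)
    ultimately show ?case by metis
  qed
  from this[of 0] show ?thesis by (simp add: \<theta>_def)
qed

end

section \<open>Spectral norms and finitely supported laws\<close>

lemma inner_eq_Re_cinner: "v \<bullet> w = Re (cinner v w)"
  by (simp add: inner_vec_def cinner_def inner_complex_def)

lemma bounded_linear_complex_matrix: "bounded_linear (\<lambda>v :: complex ^ 'n. (A :: complex ^ 'n ^ 'm) *v v)"
proof -
  have "linear (\<lambda>v. A *v v)"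
    by (rule linearI) (simp_all add: vec_eq_iff matrix_vector_mult_def sum.distrib algebra_simps
        scaleR_sum_right)
  then show ?thesis by (rule linear_conv_bounded_linear[THEN iffD1])
qed

lemma norm_mult_vec_le_spectral_norm: "norm (A *v v) \<le> spectral_norm A * norm v"
  unfolding spectral_norm_def by (rule onorm[OF bounded_linear_complex_matrix])

lemma cinner_pencil_zero_adjoint:
  "cinner (pencil n u 0 (\<lambda>i. of_real (y i)) *v v) w = cinner v (pencil n u 0 (\<lambda>i. of_real (y i)) *v w)"
proof -
  have right: "cinner v (pencil n u 0 (\<lambda>i. of_real (y i)) *v w) =
      (\<Sum>k=1..n. of_real (y k) * (cinner (u k) w * cinner v (u k)))" for v w
    by (simp add: pencil_mult_vec cinner_sum_right cinner_scale_right cinner_add_right algebra_simps)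
  have "cinner (pencil n u 0 (\<lambda>i. of_real (y i)) *v v) w =
      cnj (cinner w (pencil n u 0 (\<lambda>i. of_real (y i)) *v v))" by (rule cinner_commute)
  also have "\<dots> = (\<Sum>k=1..n. of_real (y k) * (cnj (cinner (u k) v) * cnj (cinner w (u k))))"
    by (simp add: right)
  also have "\<dots> = (\<Sum>k=1..n. of_real (y k) * (cinner (u k) w * cinner v (u k)))"
    by (simp add: cinner_commute[of _ "u _", symmetric] cinner_commute[of "u _" _, symmetric] mult.commute)
  finally show ?thesis by (simp add: right)
qed

lemma det_eq_0_if_kernel:
  fixes A :: "'a::field ^ 'm ^ 'm"
  assumes "A *v v = 0" "v \<noteq> 0"
  shows "det A = 0"
  using assms matrix_left_invertible_ker[of A] invertible_left_inverse[of A] invertible_det_nz[of A]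
  by blast

text \<open>Let a unit vector v maximise the norm of S v, with maximum c. The equality case gives S
  (S v) = c^2 v, so (S - c) (S + c) v = 0, and either v or (S + c) v is an eigenvector, for - c or
  c. One of the two determinants thus vanishes at c.\<close>

lemma spectral_norm_pencil_less:
  fixes u :: "nat \<Rightarrow> complex ^ 'm"
  assumes nz: "\<And>x. x \<ge> R \<Longrightarrow> pdet n u (of_real x) (\<lambda>i. of_real (y i)) \<noteq> 0"
    "\<And>x. x \<ge> R \<Longrightarrow> pdet n u (of_real x) (\<lambda>i. - of_real (y i)) \<noteq> 0"
  shows "spectral_norm (pencil n u 0 (\<lambda>i. of_real (y i))) < R"
proof -
  define S where "S v = pencil n u 0 (\<lambda>i. of_real (y i)) *v v" for v
  have S: "bounded_linear S" unfolding S_def by (rule bounded_linear_complex_matrix)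
  interpret S: bounded_linear S by (rule S)
  have "continuous_on (sphere 0 1) (\<lambda>v. norm (S v))"
    by (intro continuous_intros S.continuous_on)
  moreover have "compact (sphere (0 :: complex ^ 'm) 1)" "sphere (0 :: complex ^ 'm) 1 \<noteq> {}"
    by auto
  ultimately obtain v where v: "norm v = 1" and max: "\<And>w. norm w = 1 \<Longrightarrow> norm (S w) \<le> norm (S v)"
    using continuous_attains_sup[of "sphere (0 :: complex ^ 'm) 1" "\<lambda>v. norm (S v)"] by auto
  define c where "c = norm (S v)"
  have bound: "norm (S w) \<le> c * norm w" for w
  proof (cases "w = 0")
    case False
    have "norm (S ((1 / norm w) *\<^sub>R w)) \<le> c" unfolding c_def using False by (intro max) simp
    then show ?thesis using False by (simp add: S.scaleR field_simps)
  qed (simp add: S.zero)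
  have adj: "S a \<bullet> b = a \<bullet> S b" for a b
    by (simp add: inner_eq_Re_cinner S_def cinner_pencil_zero_adjoint)
  \<comment> \<open>Self-adjointness evaluates the cross term, and maximality makes the whole square
    nonpositive.\<close>
  have "(norm (S (S v) - c\<^sup>2 *\<^sub>R v))\<^sup>2 = (norm (S (S v)))\<^sup>2 - 2 * c\<^sup>2 * (v \<bullet> S (S v)) + (c\<^sup>2)\<^sup>2 * (norm v)\<^sup>2"
    unfolding power2_norm_eq_inner
    by (simp add: inner_diff_left inner_diff_right inner_commute algebra_simps power2_eq_square)
  also have "v \<bullet> S (S v) = c\<^sup>2" by (simp add: adj[symmetric] c_def power2_norm_eq_inner)
  also have "(norm (S (S v)))\<^sup>2 - 2 * c\<^sup>2 * c\<^sup>2 + (c\<^sup>2)\<^sup>2 * (norm v)\<^sup>2 \<le> 0"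
  proof -
    have "(norm (S (S v)))\<^sup>2 \<le> (c * c)\<^sup>2"
      using bound[of "S v"] by (intro power_mono) (auto simp: c_def)
    then show ?thesis using v by (simp add: power2_eq_square)
  qed
  finally have SS: "S (S v) = c\<^sup>2 *\<^sub>R v" by simp
  define w where "w = S v + c *\<^sub>R v"
  have scale: "of_real a *s b = a *\<^sub>R b" for a and b :: "complex ^ 'm"
    by (simp add: vec_eq_iff scaleR_conv_of_real[where 'a = complex])
  have plus: "pencil n u (of_real c) (\<lambda>i. of_real (y i)) *v b = c *\<^sub>R b + S b" for b
    by (simp add: S_def pencil_mult_vec scale)
  have minus: "pencil n u (of_real c) (\<lambda>i. - of_real (y i)) *v b = c *\<^sub>R b - S b" for b
    by (simp add: S_def pencil_mult_vec scale sum_negf[symmetric] vec.scale_minus_left)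
  have "pdet n u (of_real c) (\<lambda>i. of_real (y i)) = 0 \<or> pdet n u (of_real c) (\<lambda>i. - of_real (y i)) = 0"
  proof (cases "w = 0")
    case True
    then have "pencil n u (of_real c) (\<lambda>i. of_real (y i)) *v v = 0"
      by (simp add: plus w_def add.commute)
    moreover have "v \<noteq> 0" using v by auto
    ultimately show ?thesis unfolding pdet_def by (blast intro: det_eq_0_if_kernel)
  next
    case False
    have "pencil n u (of_real c) (\<lambda>i. - of_real (y i)) *v w = 0"
      by (simp add: minus w_def S.add S.scaleR SS algebra_simps power2_eq_square)
    then show ?thesis using False unfolding pdet_def by (blast intro: det_eq_0_if_kernel)
  qed
  then have "c < R" using nz[of c] by (meson not_le)
  moreover have "spectral_norm (pencil n u 0 (\<lambda>i. of_real (y i))) \<le> c"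
    unfolding spectral_norm_def S_def[symmetric]
    by (rule onorm_bound) (use bound in \<open>auto simp: c_def\<close>)
  ultimately show ?thesis by simp
qed

lemma outer_self_square: "outer_self v ** outer_self v = (norm v)\<^sup>2 *\<^sub>R outer_self v"
proof -
  have "(\<Sum>k\<in>UNIV. v $ i * cnj (v $ k) * (v $ k * cnj (v $ j))) = cinner v v * (v $ i * cnj (v $ j))" for i j
    by (simp add: cinner_def sum_distrib_left sum_distrib_right algebra_simps)
  then show ?thesis
    by (simp add: vec_eq_iff outer_self_def matrix_matrix_mult_def cinner_self scaleR_conv_of_real[where 'a = complex])
qed

lemma sum_outer_self_eq_pencil:
  "(\<Sum>i=1..n. y i *\<^sub>R outer_self (u i)) = pencil n u 0 (\<lambda>i. of_real (y i))"
  by (simp add: vec_eq_iff pencil_def outer_self_def scaleR_conv_of_real[where 'a = complex])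

lemma pencil_cong: "(\<And>i. i \<in> {1..n} \<Longrightarrow> y i = z i) \<Longrightarrow> pencil n u x y = pencil n u x z"
  by (auto simp: pencil_def vec_eq_iff intro!: sum.cong)

lemma exists_outcomes_spectral_norm:
  fixes u :: "nat \<Rightarrow> complex ^ 'm" and \<sigma> :: real
  assumes "\<sigma> > 0" "\<And>i. i \<in> {1..n} \<Longrightarrow> V i \<ge> 0"
    and \<sigma>: "spectral_norm (\<Sum>i=1..n. V i *\<^sub>R (outer_self (u i) ** outer_self (u i))) \<le> \<sigma>\<^sup>2"
    and law: "\<And>i a b c. i \<in> {1..n} \<Longrightarrow>
      (\<forall>\<omega>\<in>\<Omega> i. a + b * (\<omega> - m i) + c * (\<omega> - m i)\<^sup>2 \<le> 0) \<Longrightarrow> a + c * V i \<le> 0"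
  shows "\<exists>\<epsilon>. (\<forall>i\<in>{1..n}. \<epsilon> i \<in> \<Omega> i) \<and>
    spectral_norm ((\<Sum>i=1..n. m i *\<^sub>R outer_self (u i)) - (\<Sum>i=1..n. \<epsilon> i *\<^sub>R outer_self (u i))) < 4 * \<sigma>"
proof -
  have A: "(\<Sum>i=1..n. V i *\<^sub>R (outer_self (u i) ** outer_self (u i))) =
      pencil n u 0 (\<lambda>i. of_real (V i * (norm (u i))\<^sup>2))"
    unfolding outer_self_square scaleR_scaleR by (rule sum_outer_self_eq_pencil)
  have form: "(\<Sum>i=1..n. V i * (norm (u i))\<^sup>2 * (cmod (cinner (u i) v))\<^sup>2) \<le> \<sigma>\<^sup>2 * (norm v)\<^sup>2" for v
  proof -
    let ?A = "pencil n u 0 (\<lambda>i. of_real (V i * (norm (u i))\<^sup>2))"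
    have "(\<Sum>i=1..n. V i * (norm (u i))\<^sup>2 * (cmod (cinner (u i) v))\<^sup>2) = Re (cinner v (?A *v v))"
      unfolding cinner_pencil by simp
    also have "\<dots> \<le> norm v * norm (?A *v v)"
      using cinner_Cauchy_Schwarz complex_Re_le_cmod order_trans by blast
    also have "\<dots> \<le> norm v * (spectral_norm ?A * norm v)"
      by (intro mult_left_mono norm_mult_vec_le_spectral_norm) simp
    also have "\<dots> \<le> norm v * (\<sigma>\<^sup>2 * norm v)"
      using \<sigma> unfolding A by (intro mult_left_mono mult_right_mono) auto
    finally show ?thesis by (simp add: power2_eq_square algebra_simps)
  qed
  obtain \<epsilon> where \<epsilon>: "\<forall>i\<in>{1..n}. \<epsilon> i \<in> \<Omega> i" and
    pos: "\<And>x. x \<ge> 4 * \<sigma> \<Longrightarrow> re_fun (double_det n u (of_real x))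
      (\<lambda>(i, s). if i \<in> {1..n} then if s then \<epsilon> i - m i else - (\<epsilon> i - m i) else 0) > 0"
    using exists_outcomes[OF assms(1,2) form, of \<Omega> m] law by blast
  have "spectral_norm (pencil n u 0 (\<lambda>i. of_real (m i - \<epsilon> i))) < 4 * \<sigma>"
  proof (rule spectral_norm_pencil_less)
    fix x assume "x \<ge> 4 * \<sigma>"
    let ?\<theta> = "\<lambda>(i, s). if i \<in> {1..n} then if s then \<epsilon> i - m i else - (\<epsilon> i - m i) else 0"
    have "double_det n u (of_real x) (\<lambda>j. of_real (?\<theta> j)) \<noteq> 0"
      using pos[OF \<open>x \<ge> 4 * \<sigma>\<close>] unfolding re_fun_def by force
    moreover have "pdet n u (of_real x) (\<lambda>i. of_real (?\<theta> (i, False))) = pdet n u (of_real x) (\<lambda>i. of_real (m i - \<epsilon> i))"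
      "pdet n u (of_real x) (\<lambda>i. of_real (?\<theta> (i, True))) = pdet n u (of_real x) (\<lambda>i. - of_real (m i - \<epsilon> i))"
      unfolding pdet_def by (rule arg_cong[where f = det], rule pencil_cong, simp)+
    ultimately show "pdet n u (of_real x) (\<lambda>i. of_real (m i - \<epsilon> i)) \<noteq> 0"
      "pdet n u (of_real x) (\<lambda>i. - of_real (m i - \<epsilon> i)) \<noteq> 0"
      unfolding double_det_def by auto
  qed
  moreover have "(\<Sum>i=1..n. m i *\<^sub>R outer_self (u i)) - (\<Sum>i=1..n. \<epsilon> i *\<^sub>R outer_self (u i)) =
      pencil n u 0 (\<lambda>i. of_real (m i - \<epsilon> i))"
    unfolding sum_outer_self_eq_pencil[symmetric] by (simp add: sum_subtractf scaleR_diff_left)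
  ultimately show ?thesis using \<epsilon> by auto
qed

section \<open>Laws of finite support\<close>

context prob_space
begin

text \<open>Off the support a point lies in a null open set, hence in a null member of a countable
  basis; countably many such members form a null set.\<close>

lemma AE_in_rv_support:
  assumes X: "random_variable borel X"
  shows "AE x in M. X x \<in> rv_support M X"
proof -
  let ?D = "distr M borel X"
  interpret D: prob_space ?D using X by (rule prob_space_distr)
  obtain B :: "real set set" where B: "countable B" "topological_basis B"
    using ex_countable_basis by blast
  define N where "N = (\<Union>b\<in>{b \<in> B. measure ?D b = 0}. b)"
  have "N \<in> null_sets ?D"
    unfolding N_def
  proof (rule null_sets_UN')
    show "countable {b \<in> B. measure ?D b = 0}" using B(1) by simp
    show "b \<in> null_sets ?D" if "b \<in> {b \<in> B. measure ?D b = 0}" for b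
      using that topological_basis_open[OF B(2)] by (auto simp: null_sets_def D.emeasure_eq_measure)
  qed
  then have "AE y in ?D. y \<notin> N" by (rule AE_not_in)
  then have "AE x in M. X x \<notin> N" using X by (rule AE_distrD[rotated])
  moreover have "y \<in> rv_support M X" if "y \<notin> N" for y
    unfolding rv_support_def
  proof (intro CollectI allI impI)
    fix U assume U: "open U" "y \<in> U"
    then obtain b where b: "b \<in> B" "y \<in> b" "b \<subseteq> U" using topological_basisE[OF B(2)] by metis
    then have "measure ?D b > 0" using that by (auto simp: N_def zero_less_measure_iff)
    also have "measure ?D b \<le> measure ?D U" using b U by (intro D.finite_measure_mono) auto
    finally show "measure ?D U > 0" .
  qed
  ultimately show ?thesis by (auto elim: eventually_mono)
qed

text \<open>Integrate the quadratic: centring removes the linear term. Integrability holds because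
  almost surely only finitely many values occur.\<close>

lemma finite_support_quadratic:
  assumes X: "random_variable borel X" and fin: "finite (rv_support M X)"
    and le: "\<forall>\<omega>\<in>rv_support M X. a + b * (\<omega> - expectation X) + c * (\<omega> - expectation X)\<^sup>2 \<le> 0"
  shows "a + c * variance X \<le> 0"
proof -
  have int: "integrable M (\<lambda>x. f (X x))" if "f \<in> borel_measurable borel" for f :: "real \<Rightarrow> real"
  proof (rule integrable_const_bound)
    show "AE x in M. norm (f (X x)) \<le> (\<Sum>\<omega>\<in>rv_support M X. norm (f \<omega>))"
      using AE_in_rv_support[OF X] by eventually_elim (use fin in \<open>auto intro!: member_le_sum\<close>)
    show "(\<lambda>x. f (X x)) \<in> borel_measurable M" using X that by measurable
  qed
  have ints: "integrable M X" "integrable M (\<lambda>x. (X x - expectation X)\<^sup>2)"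
    using int[of "\<lambda>x. x"] int[of "\<lambda>x. (x - expectation X)\<^sup>2"] by auto
  have "expectation (\<lambda>x. a + b * (X x - expectation X) + c * (X x - expectation X)\<^sup>2) \<le> expectation (\<lambda>x. 0)"
  proof (rule integral_mono_AE)
    show "AE x in M. a + b * (X x - expectation X) + c * (X x - expectation X)\<^sup>2 \<le> 0"
      using AE_in_rv_support[OF X] by eventually_elim (use le in blast)
  qed (use ints in auto)
  moreover have "expectation (\<lambda>x. a + b * (X x - expectation X) + c * (X x - expectation X)\<^sup>2) = a + c * variance X"
    using ints by (simp add: prob_space)
  ultimately show ?thesis by simp
qed

end

theorem mainTheorem1:
  fixes M :: "'a measure" and n :: nat
    and \<xi> :: "nat \<Rightarrow> 'a \<Rightarrow> real"
    and u :: "nat \<Rightarrow> complex ^ 'm"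
    and \<sigma> :: real
  assumes "prob_space M"
    and "prob_space.indep_vars M (\<lambda>_. borel) \<xi> {1..n}"
    and "\<And>i. i \<in> {1..n} \<Longrightarrow> finite (rv_support M (\<xi> i))"
    and "\<sigma> \<ge> 0"
    and "\<sigma>\<^sup>2 = spectral_norm
           (\<Sum>i=1..n. prob_space.variance M (\<xi> i) *\<^sub>R (outer_self (u i) ** outer_self (u i)))"
  shows "\<exists>\<epsilon> :: nat \<Rightarrow> real. (\<forall>i\<in>{1..n}. \<epsilon> i \<in> rv_support M (\<xi> i)) \<and>
           spectral_norm
             ((\<Sum>i=1..n. prob_space.expectation M (\<xi> i) *\<^sub>R outer_self (u i)) -
              (\<Sum>i=1..n. \<epsilon> i *\<^sub>R outer_self (u i))) \<le> 4 * \<sigma>"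
proof -
  interpret prob_space M by fact
  have rv: "random_variable borel (\<xi> i)" if "i \<in> {1..n}" for i
    using assms(2) that unfolding indep_vars_def by auto
  define N where "N \<epsilon> = spectral_norm ((\<Sum>i=1..n. expectation (\<xi> i) *\<^sub>R outer_self (u i)) -
      (\<Sum>i=1..n. \<epsilon> i *\<^sub>R outer_self (u i)))" for \<epsilon>
  \<comment> \<open>Extensional functions make the choices a finite set, so one minimiser of
    \<open>N\<close> serves every e > 0 and the limit can be taken.\<close>
  define E where "E = (\<Pi>\<^sub>E i\<in>{1..n}. rv_support M (\<xi> i))"
  have "finite E" unfolding E_def using assms(3) by (intro finite_PiE) auto
  (* the strict bound needs a positive parameter, so it is applied to \<sigma> + e; this covers \<sigma> = 0 *)
  have approx: "\<exists>\<epsilon>\<in>E. N \<epsilon> \<le> 4 * (\<sigma> + e)" if "e > 0" for e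
  proof -
    have "\<sigma>\<^sup>2 \<le> (\<sigma> + e)\<^sup>2" using that assms(4) by (intro power_mono) auto
    then have "\<exists>\<epsilon>. (\<forall>i\<in>{1..n}. \<epsilon> i \<in> rv_support M (\<xi> i)) \<and> N \<epsilon> < 4 * (\<sigma> + e)"
      unfolding N_def
      using that assms(4,5) finite_support_quadratic[OF rv assms(3)]
      by (intro exists_outcomes_spectral_norm[where V = "\<lambda>i. variance (\<xi> i)"])
        (auto simp del: One_nat_def)
    then obtain \<epsilon> where \<epsilon>: "\<forall>i\<in>{1..n}. \<epsilon> i \<in> rv_support M (\<xi> i)" "N \<epsilon> < 4 * (\<sigma> + e)"
      by blast
    have "N (restrict \<epsilon> {1..n}) = N \<epsilon>" unfolding N_def by simp
    moreover have "restrict \<epsilon> {1..n} \<in> E" using \<epsilon>(1) by (auto simp: E_def)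
    ultimately show ?thesis using \<epsilon>(2) by (intro bexI[of _ "restrict \<epsilon> {1..n}"]) auto
  qed
  have "E \<noteq> {}" using approx[of 1] by auto
  then obtain \<epsilon> where \<epsilon>: "\<epsilon> \<in> E" "\<And>\<epsilon>'. \<epsilon>' \<in> E \<Longrightarrow> N \<epsilon> \<le> N \<epsilon>'"
    using \<open>finite E\<close> by (metis arg_min_if_finite(1) arg_min_least)
  have "N \<epsilon> \<le> 4 * \<sigma> + e" if e: "e > 0" for e
  proof -
    obtain \<epsilon>' where "\<epsilon>' \<in> E" "N \<epsilon>' \<le> 4 * (\<sigma> + e / 4)" using approx[of "e / 4"] e by auto
    then show ?thesis using \<epsilon>(2)[of \<epsilon>'] by simp
  qed
  then have "N \<epsilon> \<le> 4 * \<sigma>" by (rule field_le_epsilon)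
  then show ?thesis using \<epsilon>(1) unfolding N_def E_def by (intro exI[of _ \<epsilon>]) auto
qed

end
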